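(* Consider an optimal trajectory $(x,u)$ of the affine optimal control problem (P) together with its lift $p$ given by Pontryagin's Maximum Principle. Suppose the problem has intrinsic order $q$, let $t_c$ be a junction of a singular arc and a nonsingular arc of this trajectory, suppose that the matrix $B$ evaluated along the trajectory is nonsingular in a neighborhood of $t_c$, and that the control on the singular arc satisfies $|u_i(t)|<K(t)$ for $i=1,\dots,m$. If $q$ is even and $A\equiv 0$ along the singular arc, then the junction $t_c$ is not analytic.
   Context: Problem (P): minimize $\int_0^{T_f(u)} \big(f_0(x)+\sum_{i=1}^m g_{0i}(x)u_i\big)\,dt$ subject to $\dot x=f(x)+\sum_{i=1}^m g_i(x)u_i$, $x(0)=\mathcal A$, $x(T_f(u))=\mathcal B$ (given points of $\mathbb R^n$), where $u=(u_1,\dots,u_m):[0,T_f(u)]\to\mathbb R^m$ is measurable with $|u_i(t)|\le K(t)$ for all $t$ and $i$. The final time is free; $f,g_i$ are analytic vector fields on $\mathbb R^n$; $f_0,g_{0i}:\mathbb R^n\to\mathbb R$ are analytic; $K$ is analytic and strictly positive. Maximum Principle lift. Put $H_\lambda(x,p,u)=\langle p,f(x)+\sum_i g_i(x)u_i\rangle-\lambda\big(f_0(x)+\sum_i g_{0i}(x)u_i\big)$, $\lambda\in\{0,1\}$. Every optimal trajectory $(x,u)$ is considered with a lift $p(t)$ and $\lambda\in\{0,1\}$ such that $(\lambda,p(t))\ne0$ and, for almost all $t$, $\dot x=\partial H_\lambda/\partial p$, $\dot p=-\partial H_\lambda/\partial x$, $H_\lambda(x(t),p(t),u(t))=\max\{H_\lambda(x(t),p(t),w):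 |w_i|\le K(t)\}$, and $H_\lambda(x(t),p(t),u(t))=0$. Augmented notation. Add the coordinate $x_0$ with $\dot x_0=f_0(x)+\sum_i g_{0i}(x)u_i$, and from now on write $f,g_i,x,p$ for the augmented objects $(f_0,f)$, $(g_{0i},g_i)$, $(x_0,x)$, $(-\lambda,p)$ in dimension $n+1$, so that $H_\lambda=\langle p,f\rangle+\sum_i\langle p,g_i\rangle u_i$. Let $\phi_i=\langle p,g_i(x)\rangle$ and $\phi=(\phi_1,\dots,\phi_m)$, viewed along extremals. A singular interval (the trajectory restricted to it is a singular arc) is an interval on which all $\phi_i$ vanish. A nonsingular interval (nonsingular arc) is an interval on which all $\phi_i$ are nonzero almost everywhere; there the maximum condition gives $u_i(t)=\operatorname{sign}(\phi_i(t))K(t)$. A junction is a time $t_c$ which is the common endpoint of a singular interval and a nonsingular interval. Order. Differentiating $\phi$ repeatedly along extremals, let $k$ be the smallest integer such that $B_k:=\frac{\partial}{\partial u}\frac{d^k\phi}{dt^k}$ (an $m\times m$ matrix) is not identically zero as a function of $(x,p)$; then $\frac{d^k\phi}{dt^k}=A_k(x,p)+B_k(x,p)u$. The intrinsic order of the problem is $q=k/2$, assumed to be an integer; write $A=A_{2q}$, $B=B_{2q}$. The Generalized Legendre–Clebsch Condition (a result of Robbins, recalled by the paper as known) is in force: $(-1)^qB$ is negative semidefinite along singular arcs of optimal trajectories. A function is piecewise analytic on $(a,b)$ if for each $t_c\in(a,b)$ there are $t_1\in(a,t_c)$, $t_2\in(t_c,b)$ such that it is analytic on $(t_1,t_c)$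 and on $(t_c,t_2)$ (componentwise for vector-valued maps). A junction is analytic if the optimal control is piecewise analytic in a neighborhood of it. *)

theory Defs
  imports "HOL-Analysis.Analysis"
begin

section \<open>Real analytic functions\<close>

text \<open>Multi-indices are the elements of \<^term>\<open>Basis \<rightarrow>\<^sub>E (UNIV :: nat set)\<close>; \<^const>\<open>has_sum\<close> is
  unconditional (hence absolute) convergence.\<close>

definition real_analytic_at :: "('a::euclidean_space \<Rightarrow> real) \<Rightarrow> 'a \<Rightarrow> bool" where
  "real_analytic_at h a \<longleftrightarrow> (\<exists>r>0. \<exists>c. \<forall>x\<in>ball a r.
     ((\<lambda>\<alpha>. c \<alpha> * (\<Prod>b\<in>Basis. ((x - a) \<bullet> b) ^ \<alpha> b)) has_sum h x) (Basis \<rightarrow>\<^sub>E (UNIV :: nat set)))"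

definition real_analytic_on ::
    "('a::euclidean_space \<Rightarrow> 'b::euclidean_space) \<Rightarrow> 'a set \<Rightarrow> bool" where
  "real_analytic_on h S \<longleftrightarrow> (\<forall>b\<in>Basis. \<forall>a\<in>S. real_analytic_at (\<lambda>x. h x \<bullet> b) a)"

definition piecewise_analytic :: "(real \<Rightarrow> 'b::euclidean_space) \<Rightarrow> real \<Rightarrow> real \<Rightarrow> bool" where
  "piecewise_analytic h a b \<longleftrightarrow> (\<forall>t\<in>{a<..<b}. \<exists>t1\<in>{a<..<t}. \<exists>t2\<in>{t<..<b}.
     real_analytic_on h {t1<..<t} \<and> real_analytic_on h {t<..<t2})"

section \<open>The control problem\<close>

record ('n, 'm) affine_problem =
  cost_drift :: "real ^ 'n::finite \<Rightarrow> real"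
  cost_ctrl :: "'m::finite \<Rightarrow> real ^ 'n \<Rightarrow> real"
  drift :: "real ^ 'n \<Rightarrow> real ^ 'n"
  ctrl :: "'m \<Rightarrow> real ^ 'n \<Rightarrow> real ^ 'n"
  bound :: "real \<Rightarrow> real"
  source :: "real ^ 'n"
  target :: "real ^ 'n"

definition analytic_problem :: "('n::finite, 'm::finite) affine_problem \<Rightarrow> bool" where
  "analytic_problem P \<longleftrightarrow>
     real_analytic_on (cost_drift P) UNIV \<and> (\<forall>i. real_analytic_on (cost_ctrl P i) UNIV) \<and>
     real_analytic_on (drift P) UNIV \<and> (\<forall>i. real_analytic_on (ctrl P i) UNIV) \<and>
     real_analytic_on (bound P) {0..} \<and> (\<forall>t\<ge>0. bound P t > 0)"

definition running_cost ::
    "('n::finite, 'm::finite) affine_problem \<Rightarrow> real ^ 'n \<Rightarrow> real ^ 'm \<Rightarrow> real" where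
  "running_cost P x w = cost_drift P x + (\<Sum>i\<in>UNIV. cost_ctrl P i x * w $ i)"

definition velocity ::
    "('n::finite, 'm::finite) affine_problem \<Rightarrow> real ^ 'n \<Rightarrow> real ^ 'm \<Rightarrow> real ^ 'n" where
  "velocity P x w = drift P x + (\<Sum>i\<in>UNIV. w $ i *\<^sub>R ctrl P i x)"

text \<open>The curve \<open>y\<close> is absolutely continuous on \<open>[0, T]\<close> and its derivative is \<open>v\<close> almost
  everywhere.\<close>

definition ae_derivative_on ::
    "real \<Rightarrow> (real \<Rightarrow> 'a::euclidean_space) \<Rightarrow> (real \<Rightarrow> 'a) \<Rightarrow> bool" where
  "ae_derivative_on T y v \<longleftrightarrow> v absolutely_integrable_on {0..T} \<and>
     (\<forall>t\<in>{0..T}. y t = y 0 + integral {0..t} v)"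

definition control_box :: "('n::finite, 'm::finite) affine_problem \<Rightarrow> real \<Rightarrow> (real ^ 'm) set" where
  "control_box P t = {w. \<forall>i. \<bar>w $ i\<bar> \<le> bound P t}"

definition admissible ::
    "('n::finite, 'm::finite) affine_problem \<Rightarrow> real \<Rightarrow> (real \<Rightarrow> real ^ 'm) \<Rightarrow>
     (real \<Rightarrow> real ^ 'n) \<Rightarrow> bool" where
  "admissible P T u x \<longleftrightarrow> 0 < T \<and>
     u \<in> borel_measurable (lebesgue_on {0..T}) \<and> (\<forall>t\<in>{0..T}. u t \<in> control_box P t) \<and>
     ae_derivative_on T x (\<lambda>t. velocity P (x t) (u t)) \<and> x 0 = source P \<and> x T = target P"

definition total_cost ::
    "('n::finite, 'm::finite) affine_problem \<Rightarrow> real \<Rightarrow> (real \<Rightarrow> real ^ 'm) \<Rightarrow>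
     (real \<Rightarrow> real ^ 'n) \<Rightarrow> real" where
  "total_cost P T u x = integral {0..T} (\<lambda>t. running_cost P (x t) (u t))"

definition optimal ::
    "('n::finite, 'm::finite) affine_problem \<Rightarrow> real \<Rightarrow> (real \<Rightarrow> real ^ 'm) \<Rightarrow>
     (real \<Rightarrow> real ^ 'n) \<Rightarrow> bool" where
  "optimal P T u x \<longleftrightarrow> admissible P T u x \<and>
     (\<forall>T' u' x'. admissible P T' u' x' \<longrightarrow> total_cost P T u x \<le> total_cost P T' u' x')"

section \<open>The Maximum Principle\<close>

definition grad :: "('a::euclidean_space \<Rightarrow> real) \<Rightarrow> 'a \<Rightarrow> 'a" where
  "grad h x = (THE D. GDERIV h x :> D)"

definition hamiltonian ::
    "('n::finite, 'm::finite) affine_problem \<Rightarrow> real \<Rightarrow> real ^ 'n \<Rightarrow> real ^ 'n \<Rightarrow>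
     real ^ 'm \<Rightarrow> real" where
  "hamiltonian P l x p w = p \<bullet> velocity P x w - l * running_cost P x w"

definition pmp_lift ::
    "('n::finite, 'm::finite) affine_problem \<Rightarrow> real \<Rightarrow> (real \<Rightarrow> real ^ 'm) \<Rightarrow>
     (real \<Rightarrow> real ^ 'n) \<Rightarrow> real \<Rightarrow> (real \<Rightarrow> real ^ 'n) \<Rightarrow> bool" where
  "pmp_lift P T u x l p \<longleftrightarrow>
     l \<in> {0, 1} \<and> (\<forall>t\<in>{0..T}. (l, p t) \<noteq> 0) \<and>
     ae_derivative_on T x (\<lambda>t. grad (\<lambda>q. hamiltonian P l (x t) q (u t)) (p t)) \<and>
     ae_derivative_on T p (\<lambda>t. - grad (\<lambda>y. hamiltonian P l y (p t) (u t)) (x t)) \<and>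
     (AE t in lebesgue_on {0..T}.
        (\<forall>w\<in>control_box P t. hamiltonian P l (x t) (p t) w \<le> hamiltonian P l (x t) (p t) (u t)) \<and>
        hamiltonian P l (x t) (p t) (u t) = 0)"

section \<open>Augmented objects and intrinsic order\<close>

type_synonym 'n aug = "real \<times> (real ^ 'n)"

definition aug_drift :: "('n::finite, 'm::finite) affine_problem \<Rightarrow> 'n aug \<Rightarrow> 'n aug" where
  "aug_drift P X = (cost_drift P (snd X), drift P (snd X))"

definition aug_ctrl :: "('n::finite, 'm::finite) affine_problem \<Rightarrow> 'm \<Rightarrow> 'n aug \<Rightarrow> 'n aug" where
  "aug_ctrl P i X = (cost_ctrl P i (snd X), ctrl P i (snd X))"

definition aug_hamiltonian ::
    "('n::finite, 'm::finite) affine_problem \<Rightarrow> 'n aug \<Rightarrow> 'n aug \<Rightarrow> real ^ 'm \<Rightarrow> real" where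
  "aug_hamiltonian P X Q w = Q \<bullet> aug_drift P X + (\<Sum>i\<in>UNIV. (Q \<bullet> aug_ctrl P i X) * w $ i)"

definition hamiltonian_field ::
    "('n::finite, 'm::finite) affine_problem \<Rightarrow> 'n aug \<times> 'n aug \<Rightarrow> real ^ 'm \<Rightarrow>
     'n aug \<times> 'n aug" where
  "hamiltonian_field P z w =
     (grad (\<lambda>Q. aug_hamiltonian P (fst z) Q w) (snd z),
      - grad (\<lambda>X. aug_hamiltonian P X (snd z) w) (fst z))"

definition switching ::
    "('n::finite, 'm::finite) affine_problem \<Rightarrow> 'n aug \<times> 'n aug \<Rightarrow> real ^ 'm" where
  "switching P z = (\<chi> i. snd z \<bullet> aug_ctrl P i (fst z))"

text \<open>The \<open>k\<close>-th time derivative of the switching function along extremals, as a function of state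
  and costate \<open>z\<close> and control value \<open>w\<close>. Terms with derivatives of the control are absent: they can
  only appear after the control itself has, so not up to the first \<open>k\<close> for which \<open>B_coef P k\<close> is not
  identically zero. Up to that \<open>k\<close> the expression is affine in \<open>w\<close>, so the Jacobian in \<open>B_coef\<close> may
  be taken at any \<open>w\<close>.\<close>

primrec switching_deriv ::
    "('n::finite, 'm::finite) affine_problem \<Rightarrow> nat \<Rightarrow> 'n aug \<times> 'n aug \<Rightarrow> real ^ 'm \<Rightarrow>
     real ^ 'm" where
  "switching_deriv P 0 z w = switching P z"
| "switching_deriv P (Suc k) z w =
     frechet_derivative (\<lambda>z'. switching_deriv P k z' w) (at z) (hamiltonian_field P z w)"

definition A_coef ::
    "('n::finite, 'm::finite) affine_problem \<Rightarrow> nat \<Rightarrow> 'n aug \<times> 'n aug \<Rightarrow> real ^ 'm" where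
  "A_coef P k z = switching_deriv P k z 0"

definition B_coef ::
    "('n::finite, 'm::finite) affine_problem \<Rightarrow> nat \<Rightarrow> 'n aug \<times> 'n aug \<Rightarrow> real ^ 'm ^ 'm" where
  "B_coef P k z = jacobian (switching_deriv P k z) (at 0)"

definition has_intrinsic_order :: "('n::finite, 'm::finite) affine_problem \<Rightarrow> nat \<Rightarrow> bool" where
  "has_intrinsic_order P q \<longleftrightarrow>
     (\<exists>z. B_coef P (2 * q) z \<noteq> 0) \<and> (\<forall>k<2 * q. \<forall>z. B_coef P k z = 0)"

definition extremal ::
    "('n::finite, 'm::finite) affine_problem \<Rightarrow> (real \<Rightarrow> real ^ 'm) \<Rightarrow> (real \<Rightarrow> real ^ 'n) \<Rightarrow>
     real \<Rightarrow> (real \<Rightarrow> real ^ 'n) \<Rightarrow> real \<Rightarrow> 'n aug \<times> 'n aug" where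
  "extremal P u x l p t =
     ((integral {0..t} (\<lambda>s. running_cost P (x s) (u s)), x t), (- l, p t))"

section \<open>Arcs and junctions\<close>

definition time_interval :: "real \<Rightarrow> real set \<Rightarrow> bool" where
  "time_interval T J \<longleftrightarrow> is_interval J \<and> interior J \<noteq> {} \<and> J \<subseteq> {0..T}"

text \<open>In this section \<open>z\<close> is an extremal on \<open>[0, T]\<close>.\<close>

definition singular_interval ::
    "('n::finite, 'm::finite) affine_problem \<Rightarrow> real \<Rightarrow> (real \<Rightarrow> 'n aug \<times> 'n aug) \<Rightarrow>
     real set \<Rightarrow> bool" where
  "singular_interval P T z J \<longleftrightarrow>
     time_interval T J \<and> (\<forall>t\<in>J. \<forall>i. switching P (z t) $ i = 0)"

definition nonsingular_interval ::
    "('n::finite, 'm::finite) affine_problem \<Rightarrow> real \<Rightarrow> (real \<Rightarrow> 'n aug \<times> 'n aug) \<Rightarrow>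
     real set \<Rightarrow> bool" where
  "nonsingular_interval P T z J \<longleftrightarrow>
     time_interval T J \<and> (\<forall>i. AE t in lebesgue_on J. switching P (z t) $ i \<noteq> 0)"

text \<open>The frontier of a nondegenerate interval consists of its endpoints.\<close>

definition junction ::
    "('n::finite, 'm::finite) affine_problem \<Rightarrow> real \<Rightarrow> (real \<Rightarrow> 'n aug \<times> 'n aug) \<Rightarrow>
     real \<Rightarrow> real set \<Rightarrow> real set \<Rightarrow> bool" where
  "junction P T z tc S N \<longleftrightarrow>
     singular_interval P T z S \<and> nonsingular_interval P T z N \<and> tc \<in> frontier S \<inter> frontier N"

text \<open>Controls matter only up to null sets, so a control is regarded as piecewise analytic when it
  has a piecewise analytic representative; non-analyticity is then not an artefact of its values on
  a null set.\<close>

definition analytic_junction :: "(real \<Rightarrow> real ^ 'm::finite) \<Rightarrow> real \<Rightarrow> bool" where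
  "analytic_junction u tc \<longleftrightarrow> (\<exists>a b v. a < tc \<and> tc < b \<and>
     (AE t in lebesgue_on {a<..<b}. v t = u t) \<and> piecewise_analytic v a b)"

definition negative_semidefinite :: "real ^ 'm ^ 'm::finite \<Rightarrow> bool" where
  "negative_semidefinite M \<longleftrightarrow> (\<forall>w. w \<bullet> (M *v w) \<le> 0)"

definition glc_condition ::
    "('n::finite, 'm::finite) affine_problem \<Rightarrow> nat \<Rightarrow> (real \<Rightarrow> 'n aug \<times> 'n aug) \<Rightarrow>
     real set \<Rightarrow> bool" where
  "glc_condition P q z S \<longleftrightarrow>
     (\<forall>t\<in>S. negative_semidefinite ((-1) ^ q *\<^sub>R B_coef P (2 * q) (z t)))"

end

theory Submission
  imports Defs
begin

text \<open>Suppose the control is piecewise analytic around \<open>tc\<close>. On the nonsingular side the maximum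
  condition and continuity force \<open>u = K \<epsilon>\<close> with constant signs \<open>\<epsilon>\<^sub>i\<close> and \<open>\<epsilon>\<^sub>i \<phi>\<^sub>i \<ge> 0\<close>. At \<open>tc\<close> all
  derivatives of \<open>\<phi>\<close> of order below \<open>2q\<close> vanish, since they are functions of state and costate alone
  and vanish on the singular side; as \<open>A = 0\<close> there, the one-sided derivative of order \<open>2q\<close> is
  \<open>K B \<epsilon>\<close>. The order \<open>2q\<close> is even, so \<open>\<epsilon>\<^sub>i (B \<epsilon>)\<^sub>i \<ge> 0\<close> for every \<open>i\<close>, on whichever side the
  nonsingular arc lies. For even \<open>q\<close> the Legendre--Clebsch condition gives
  \<open>\<epsilon> \<bullet> B \<epsilon> \<le> 0\<close>; hence all \<open>\<epsilon>\<^sub>i (B \<epsilon>)\<^sub>i\<close> vanish and \<open>B \<epsilon> = 0\<close>, contradicting invertibility.\<close>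

section \<open>Termwise differentiation of power series\<close>

lemma real_analytic_at_cong:
  assumes "real_analytic_at g a" and "0 < r" and "\<And>x. x \<in> ball a r \<Longrightarrow> f x = g x"
  shows "real_analytic_at f a"
proof -
  obtain s c where s: "s > 0" and hs: "\<forall>x\<in>ball a s.
     ((\<lambda>\<alpha>. c \<alpha> * (\<Prod>b\<in>Basis. ((x - a) \<bullet> b) ^ \<alpha> b)) has_sum g x) (Basis \<rightarrow>\<^sub>E (UNIV :: nat set))"
    using assms(1) unfolding real_analytic_at_def by blast
  have "\<forall>x\<in>ball a (min r s).
     ((\<lambda>\<alpha>. c \<alpha> * (\<Prod>b\<in>Basis. ((x - a) \<bullet> b) ^ \<alpha> b)) has_sum f x) (Basis \<rightarrow>\<^sub>E (UNIV :: nat set))"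
    using hs assms(3) by auto
  then show ?thesis
    unfolding real_analytic_at_def using s \<open>0 < r\<close> by (intro exI[of _ "min r s"] conjI exI[of _ c]) auto
qed

section \<open>Multi-indices and majorants for differentiated monomials\<close>

text \<open>The multi-indices are countable; being infinite as well, they can be enumerated by the
  naturals, which makes theorems on series of functions applicable.\<close>

lemma infinite_multi_indices: "infinite ((Basis :: 'a::euclidean_space set) \<rightarrow>\<^sub>E (UNIV :: nat set))"
proof
  assume fin: "finite ((Basis :: 'a set) \<rightarrow>\<^sub>E (UNIV :: nat set))"
  obtain b0 :: 'a where b0: "b0 \<in> Basis" using nonempty_Basis by blast
  have "(\<lambda>\<alpha>. \<alpha> b0) ` ((Basis :: 'a set) \<rightarrow>\<^sub>E (UNIV :: nat set)) = UNIV"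
  proof -
    have "n \<in> (\<lambda>\<alpha>. \<alpha> b0) ` ((Basis :: 'a set) \<rightarrow>\<^sub>E (UNIV :: nat set))" for n
      by (rule image_eqI[where x="restrict (\<lambda>_. n) Basis"]) (use b0 in auto)
    then show ?thesis by auto
  qed
  with finite_imageI[OF fin, of "\<lambda>\<alpha>. \<alpha> b0"] show False by simp
qed

text \<open>Differentiating a power produces the factor \<open>n\<close>. Halving the radius
  supplies \<open>(1/2) ^ (n - 1)\<close>, which absorbs it.\<close>

lemma real_of_nat_le_two_power: "real n * (1/2) ^ (n - 1) \<le> 2"
proof (cases n)
  case (Suc k)
  have "real n \<le> 2 ^ n"
    using less_imp_le[OF of_nat_less_two_power] .
  then show ?thesis
    by (simp add: Suc field_simps)
qed simp

text \<open>This is the partial derivative in direction \<open>b\<close> of the monomial with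
  exponent \<open>\<alpha>\<close>, at displacement \<open>y\<close>. Truncated subtraction does no
  harm: for \<open>\<alpha> b = 0\<close> the leading factor is 0.\<close>

definition power_term_partial ::
    "('a::euclidean_space \<Rightarrow> nat) \<Rightarrow> 'a \<Rightarrow> 'a \<Rightarrow> real" where
  "power_term_partial \<alpha> b y =
     of_nat (\<alpha> b) * (y \<bullet> b) ^ (\<alpha> b - 1) * (\<Prod>b'\<in>Basis - {b}. (y \<bullet> b') ^ \<alpha> b')"

lemma has_derivative_power_term:
  "((\<lambda>x. \<Prod>b\<in>Basis. ((x - a) \<bullet> b) ^ \<alpha> b) has_derivative
      (\<lambda>h. \<Sum>b\<in>Basis. (h \<bullet> b) * power_term_partial \<alpha> b (x - a))) (at x within S)"
proof (rule has_derivative_eq_rhs, rule has_derivative_prod)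
  show "((\<lambda>x. ((x - a) \<bullet> b) ^ \<alpha> b) has_derivative
      (\<lambda>h. of_nat (\<alpha> b) * (h \<bullet> b) * ((x - a) \<bullet> b) ^ (\<alpha> b - 1))) (at x within S)" for b
    by (rule has_derivative_power) (auto intro!: derivative_eq_intros)
qed (simp add: power_term_partial_def mult_ac)

text \<open>The right-hand side is, up to a constant independent of \<open>\<alpha>\<close>, the
  monomial evaluated at the corner with all coordinates \<open>\<rho>\<close>. Convergence at that
  one point therefore majorizes every differentiated series on the ball of half the radius.\<close>

lemma power_term_partial_bound:
  assumes b: "b \<in> Basis" and "0 < \<rho>" and y: "norm y \<le> \<rho> / 2"
  shows "\<bar>power_term_partial \<alpha> b y\<bar> \<le> 2 / \<rho> * (\<Prod>b\<in>Basis. \<rho> ^ \<alpha> b)"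
proof -
  have le: "\<bar>y \<bullet> b'\<bar> \<le> \<rho> / 2" if "b' \<in> Basis" for b'
    using Basis_le_norm[OF that, of y] y by linarith
  have 1: "of_nat (\<alpha> b) * \<bar>y \<bullet> b\<bar> ^ (\<alpha> b - 1) \<le> 2 / \<rho> * \<rho> ^ \<alpha> b"
  proof (cases "\<alpha> b")
    case (Suc k)
    have "of_nat (\<alpha> b) * \<bar>y \<bullet> b\<bar> ^ (\<alpha> b - 1) \<le> of_nat (\<alpha> b) * (\<rho> / 2) ^ (\<alpha> b - 1)"
      by (intro mult_left_mono power_mono le b) auto
    also have "\<dots> = (of_nat (\<alpha> b) * (1/2) ^ (\<alpha> b - 1)) * \<rho> ^ (\<alpha> b - 1)"
      by (simp add: power_divide)
    also have "\<dots> \<le> 2 * \<rho> ^ (\<alpha> b - 1)"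
      using real_of_nat_le_two_power \<open>0 < \<rho>\<close> by (intro mult_right_mono) auto
    finally show ?thesis using Suc \<open>0 < \<rho>\<close> by simp
  qed (use \<open>0 < \<rho>\<close> in simp)
  have 2: "(\<Prod>b'\<in>Basis - {b}. \<bar>y \<bullet> b'\<bar> ^ \<alpha> b') \<le> (\<Prod>b'\<in>Basis - {b}. \<rho> ^ \<alpha> b')"
  proof (intro prod_mono conjI power_mono)
    fix b' :: 'a assume "b' \<in> Basis - {b}"
    then show "\<bar>y \<bullet> b'\<bar> \<le> \<rho>" using le[of b'] \<open>0 < \<rho>\<close> by simp
  qed auto
  have "\<bar>power_term_partial \<alpha> b y\<bar>
      = (of_nat (\<alpha> b) * \<bar>y \<bullet> b\<bar> ^ (\<alpha> b - 1)) * (\<Prod>b'\<in>Basis - {b}. \<bar>y \<bullet> b'\<bar> ^ \<alpha> b')"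
    by (simp add: power_term_partial_def abs_mult abs_prod power_abs)
  also have "\<dots> \<le> (2 / \<rho> * \<rho> ^ \<alpha> b) * (\<Prod>b'\<in>Basis - {b}. \<rho> ^ \<alpha> b')"
    by (intro mult_mono 1 2 prod_nonneg) (use \<open>0 < \<rho>\<close> in auto)
  also have "\<dots> = 2 / \<rho> * (\<Prod>b\<in>Basis. \<rho> ^ \<alpha> b)"
    using b by (simp add: prod.remove mult.assoc)
  finally show ?thesis .
qed

text \<open>Absolute convergence at a corner point bounds all termwise partials by one summable
  sequence. Uniform convergence then justifies termwise differentiation, and shifting exponents
  exhibits each partial as a power series again.\<close>

lemma real_analytic_at_partials:
  fixes h :: "'a::euclidean_space \<Rightarrow> real"
  assumes "real_analytic_at h a"
  obtains r g where "0 < r" and "\<And>b. b \<in> Basis \<Longrightarrow> real_analytic_at (g b) a"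
    and "\<And>x. x \<in> ball a r \<Longrightarrow> (h has_derivative (\<lambda>v. \<Sum>b\<in>Basis. (v \<bullet> b) * g b x)) (at x)"
proof -
  let ?I = "Basis \<rightarrow>\<^sub>E (UNIV :: nat set) :: ('a \<Rightarrow> nat) set"
  obtain r c where r: "r > 0" and hs: "\<And>x. x \<in> ball a r \<Longrightarrow>
     ((\<lambda>\<alpha>. c \<alpha> * (\<Prod>b\<in>Basis. ((x - a) \<bullet> b) ^ \<alpha> b)) has_sum h x) ?I"
    using assms unfolding real_analytic_at_def by blast
  \<comment> \<open>With this radius the corner \<open>a + \<rho> *\<^sub>R One\<close> is at
    distance at most \<open>r / 2\<close> from \<open>a\<close>, hence inside the ball of
    convergence.\<close>
  define \<rho> where "\<rho> = r / (2 * DIM('a))"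
  have \<rho>: "0 < \<rho>" using r by (simp add: \<rho>_def)
  have \<rho>r: "\<rho> \<le> r"
  proof -
    have "real DIM('a) \<ge> 1" using DIM_positive[where 'a='a] by linarith
    then have "1 \<le> 2 * real DIM('a)" by linarith
    from mult_left_mono[OF this] have "r * 1 \<le> r * (2 * real DIM('a))" using r by simp
    then show ?thesis using DIM_positive[where 'a='a] by (simp add: \<rho>_def divide_le_eq)
  qed
  define M where "M = (\<lambda>\<alpha>. \<bar>c \<alpha>\<bar> * (\<Prod>b\<in>Basis. \<rho> ^ \<alpha> b))"
  have M: "M summable_on ?I"
  proof -
    define x0 where "x0 = a + \<rho> *\<^sub>R One"
    have "norm (One :: 'a) \<le> DIM('a)"
      by (rule order_trans[OF norm_sum]) simp
    then have "norm (\<rho> *\<^sub>R (One :: 'a)) \<le> \<rho> * DIM('a)"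
      using \<rho> by simp
    also have "\<dots> < r" using r by (simp add: \<rho>_def)
    finally have "x0 \<in> ball a r" by (simp add: x0_def dist_norm norm_minus_commute)
    from hs[OF this] have "(\<lambda>\<alpha>. c \<alpha> * (\<Prod>b\<in>Basis. ((x0 - a) \<bullet> b) ^ \<alpha> b)) summable_on ?I"
      by (auto simp: summable_on_def)
    then have "(\<lambda>\<alpha>. norm (c \<alpha> * (\<Prod>b\<in>Basis. ((x0 - a) \<bullet> b) ^ \<alpha> b))) summable_on ?I"
      by (rule iffD1[OF summable_on_iff_abs_summable_on_real])
    also have "(\<lambda>\<alpha>. norm (c \<alpha> * (\<Prod>b\<in>Basis. ((x0 - a) \<bullet> b) ^ \<alpha> b))) = M"
    proof
      fix \<alpha> :: "'a \<Rightarrow> nat"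
      have "(x0 - a) \<bullet> b = \<rho>" if "b \<in> Basis" for b
        using that by (simp add: x0_def)
      then have "(\<Prod>b\<in>Basis. ((x0 - a) \<bullet> b) ^ \<alpha> b) = (\<Prod>b\<in>Basis. \<rho> ^ \<alpha> b)"
        by (intro prod.cong) auto
      then show "norm (c \<alpha> * (\<Prod>b\<in>Basis. ((x0 - a) \<bullet> b) ^ \<alpha> b)) = M \<alpha>"
        using \<rho> by (simp add: M_def abs_mult prod_nonneg)
    qed
    finally show ?thesis .
  qed
  define e where "e = from_nat_into ?I"
  have e: "bij_betw e UNIV ?I"
    unfolding e_def by (intro bij_betw_from_nat_into countable_PiE infinite_multi_indices) auto
  have Me: "summable (\<lambda>n. M (e n))"
    using M by (intro summable_on_imp_summable) (subst summable_on_reindex_bij_betw[OF e])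
  define S where "S = ball a (\<rho> / 2)"
  define d where "d = (\<lambda>b \<alpha> x. c \<alpha> * power_term_partial \<alpha> b (x - a))"
  have d_bound: "\<bar>d b \<alpha> x\<bar> \<le> 2 / \<rho> * M \<alpha>" if "b \<in> Basis" "x \<in> S" for b \<alpha> x
  proof -
    have "\<bar>power_term_partial \<alpha> b (x - a)\<bar> \<le> 2 / \<rho> * (\<Prod>b\<in>Basis. \<rho> ^ \<alpha> b)"
      using that by (intro power_term_partial_bound \<rho>) (auto simp: S_def dist_norm norm_minus_commute)
    from mult_left_mono[OF this abs_ge_zero, of "c \<alpha>"] show ?thesis
      by (simp add: d_def M_def abs_mult mult_ac)
  qed
  define g where "g = (\<lambda>b x. \<Sum>n. d b (e n) x)"
  have d_summable: "summable (\<lambda>n. norm (d b (e n) x))" if "b \<in> Basis" "x \<in> S" for b x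
    by (rule summable_comparison_test'[OF summable_mult[OF Me, of "2 / \<rho>"]])
       (use d_bound[OF that] in auto)
  have g_sum: "((\<lambda>\<alpha>. d b \<alpha> x) has_sum g b x) ?I" if "b \<in> Basis" "x \<in> S" for b x
  proof -
    have "((\<lambda>n. d b (e n) x) has_sum g b x) UNIV"
      unfolding g_def using d_summable[OF that]
      by (rule norm_summable_imp_has_sum) (rule summable_sums[OF summable_norm_cancel[OF d_summable[OF that]]])
    then show ?thesis by (subst (asm) has_sum_reindex_bij_betw[OF e])
  qed
  have g_unif: "uniform_limit S (\<lambda>N x. \<Sum>n<N. d b (e n) x) (g b) sequentially" if "b \<in> Basis" for b
    unfolding g_def
  proof (rule Weierstrass_m_test[OF _ summable_mult[OF Me]])
    show "norm (d b (e n) x) \<le> 2 / \<rho> * M (e n)" if "x \<in> S" for n x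
      using d_bound[OF \<open>b \<in> Basis\<close> that] by simp
  qed
  have g_analytic: "real_analytic_at (g b) a" if b: "b \<in> Basis" for b
  proof -
    \<comment> \<open>Coefficients of the differentiated series: the coefficient at exponent
      \<open>\<beta>\<close> comes from the term whose exponent at \<open>b\<close> is one
      larger.\<close>
    define c' where "c' = (\<lambda>\<beta>. c (\<beta>(b := Suc (\<beta> b))) * Suc (\<beta> b))"
    have "((\<lambda>\<beta>. c' \<beta> * (\<Prod>b\<in>Basis. ((x - a) \<bullet> b) ^ \<beta> b)) has_sum g b x) ?I" if x: "x \<in> S" for x
    proof -
      \<comment> \<open>Terms with \<open>\<alpha> b = 0\<close> differentiate to zero. On the
        remaining ones, lowering the exponent at \<open>b\<close> is a bijection onto all
        multi-indices.\<close>
      let ?J = "{\<alpha> \<in> ?I. \<alpha> b \<noteq> 0}"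
      have "((\<lambda>\<alpha>. d b \<alpha> x) has_sum g b x) ?J"
      proof (rule iffD1[OF has_sum_cong_neutral g_sum[OF b x]])
        show "d b \<alpha> x = 0" if "\<alpha> \<in> ?I - ?J" for \<alpha>
          using that by (simp add: d_def power_term_partial_def)
      qed auto
      also have "?this \<longleftrightarrow> ?thesis"
      proof (rule has_sum_reindex_bij_witness
          [where j="\<lambda>\<alpha>. \<alpha>(b := \<alpha> b - 1)" and i="\<lambda>\<beta>. \<beta>(b := Suc (\<beta> b))"])
        fix \<alpha> assume \<alpha>: "\<alpha> \<in> ?J"
        have "(\<Prod>b'\<in>Basis. ((x - a) \<bullet> b') ^ (\<alpha>(b := \<alpha> b - 1)) b')
            = ((x - a) \<bullet> b) ^ (\<alpha> b - 1) * (\<Prod>b'\<in>Basis - {b}. ((x - a) \<bullet> b') ^ \<alpha> b')"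
          by (subst prod.remove[OF finite_Basis b]) (auto intro!: prod.cong)
        moreover have "(\<alpha>(b := \<alpha> b - 1))(b := Suc ((\<alpha>(b := \<alpha> b - 1)) b)) = \<alpha>"
          using \<alpha> by auto
        ultimately show "c' (\<alpha>(b := \<alpha> b - 1)) * (\<Prod>b'\<in>Basis. ((x - a) \<bullet> b') ^ (\<alpha>(b := \<alpha> b - 1)) b')
            = d b \<alpha> x"
          using \<alpha> by (simp add: c'_def d_def power_term_partial_def)
      next
        fix \<alpha> assume \<alpha>: "\<alpha> \<in> ?J"
        show "(\<alpha>(b := \<alpha> b - 1))(b := Suc ((\<alpha>(b := \<alpha> b - 1)) b)) = \<alpha>"
          using \<alpha> by auto
        show "\<alpha>(b := \<alpha> b - 1) \<in> ?I"
          using \<alpha> b by (simp add: PiE_def extensional_def)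
      next
        fix \<beta> assume \<beta>: "\<beta> \<in> ?I"
        show "(\<beta>(b := Suc (\<beta> b)))(b := (\<beta>(b := Suc (\<beta> b))) b - 1) = \<beta>"
          by simp
        show "\<beta>(b := Suc (\<beta> b)) \<in> ?J"
          using \<beta> b by (simp add: PiE_def extensional_def)
      qed (rule refl)
      finally show ?thesis .
    qed
    then show ?thesis
      unfolding real_analytic_at_def S_def using \<rho> by (intro exI[of _ "\<rho> / 2"] conjI exI[of _ c']) auto
  qed
  let ?f = "\<lambda>n x. c (e n) * (\<Prod>b\<in>Basis. ((x - a) \<bullet> b) ^ e n b)"
  let ?f' = "\<lambda>n x v. \<Sum>b\<in>Basis. (v \<bullet> b) * d b (e n) x"
  let ?g' = "\<lambda>x v. \<Sum>b\<in>Basis. (v \<bullet> b) * g b x"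
  have f_sums: "(\<lambda>n. ?f n x) sums h x" if "x \<in> ball a r" for x
    using hs[OF that] by (intro has_sum_imp_sums) (subst has_sum_reindex_bij_betw[OF e])
  have Sr: "S \<subseteq> ball a r" using \<rho>r \<rho> by (auto simp: S_def)
  have "\<exists>k. \<forall>x\<in>S. (\<lambda>n. ?f n x) sums k x \<and> (k has_derivative ?g' x) (at x within S)"
  proof (rule has_derivative_series[where f'="?f'" and x=a and l="h a"])
    show "convex S" by (simp add: S_def)
    show "(?f n has_derivative ?f' n x) (at x within S)" for n x
      by (rule has_derivative_eq_rhs, rule has_derivative_mult_right, rule has_derivative_power_term)
         (simp add: d_def sum_distrib_left mult_ac)
    show "a \<in> S" using \<rho> by (simp add: S_def)
    show "(\<lambda>n. ?f n a) sums h a" by (rule f_sums) (simp add: r)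
  next
    fix \<epsilon> :: real assume \<epsilon>: "\<epsilon> > 0"
    \<comment> \<open>The admissible error is shared equally among the \<open>DIM('a)\<close>
      partial derivatives.\<close>
    define \<delta> where "\<delta> = \<epsilon> / DIM('a)"
    have "\<delta> > 0" using \<epsilon> by (simp add: \<delta>_def)
    have "\<forall>\<^sub>F N in sequentially. \<forall>b\<in>Basis. \<forall>x\<in>S. dist (\<Sum>n<N. d b (e n) x) (g b x) < \<delta>"
      using g_unif \<open>\<delta> > 0\<close> by (subst eventually_ball_finite_distrib) (auto simp: uniform_limit_iff)
    then show "\<forall>\<^sub>F N in sequentially. \<forall>x\<in>S. \<forall>v. norm ((\<Sum>n<N. ?f' n x v) - ?g' x v) \<le> \<epsilon> * norm v"
    proof (rule eventually_mono, intro ballI allI)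
      fix N x v
      assume N: "\<forall>b\<in>Basis. \<forall>x\<in>S. dist (\<Sum>n<N. d b (e n) x) (g b x) < \<delta>" and x: "x \<in> S"
      have "(\<Sum>n<N. ?f' n x v) - ?g' x v = (\<Sum>b\<in>Basis. (v \<bullet> b) * ((\<Sum>n<N. d b (e n) x) - g b x))"
        by (subst sum.swap) (simp add: sum_distrib_left right_diff_distrib sum_subtractf)
      also have "norm \<dots> \<le> (\<Sum>b\<in>(Basis :: 'a set). norm v * \<delta>)"
      proof (rule sum_norm_le)
        fix b :: 'a assume b: "b \<in> Basis"
        have "\<bar>(\<Sum>n<N. d b (e n) x) - g b x\<bar> \<le> \<delta>"
          using N b x by (force simp: dist_real_def)
        then show "norm ((v \<bullet> b) * ((\<Sum>n<N. d b (e n) x) - g b x)) \<le> norm v * \<delta>"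
          unfolding real_norm_def abs_mult by (intro mult_mono Basis_le_norm b) auto
      qed
      also have "\<dots> = \<epsilon> * norm v" by (simp add: \<delta>_def)
      finally show "norm ((\<Sum>n<N. ?f' n x v) - ?g' x v) \<le> \<epsilon> * norm v" .
    qed
  qed
  then obtain k where k: "\<And>x. x \<in> S \<Longrightarrow> (\<lambda>n. ?f n x) sums k x"
    and k': "\<And>x. x \<in> S \<Longrightarrow> (k has_derivative ?g' x) (at x within S)" by blast
  have kh: "k x = h x" if "x \<in> S" for x
    using k[OF that] f_sums[of x] that Sr sums_unique2 by blast
  have "(h has_derivative ?g' x) (at x)" if x: "x \<in> ball a (\<rho> / 2)" for x
  proof -
    have S: "open S" "x \<in> S" using x by (simp_all add: S_def)
    from k'[OF S(2)] have "(k has_derivative ?g' x) (at x)"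
      by (simp only: at_within_open[OF S(2,1)])
    then show ?thesis
      using S by (rule has_derivative_transform_within_open) (rule kh)
  qed
  then show thesis
    using that[of "\<rho> / 2" g] \<rho> g_analytic by simp
qed

section \<open>Differentiability and analyticity of directional derivatives\<close>

corollary real_analytic_at_imp_differentiable:
  "real_analytic_at h a \<Longrightarrow> h differentiable (at a)"
proof (erule real_analytic_at_partials)
  fix r g
  assume "0 < r" and d: "\<And>x. x \<in> ball a r \<Longrightarrow> (h has_derivative (\<lambda>v. \<Sum>b\<in>Basis. v \<bullet> b * g b x)) (at x)"
  show "h differentiable at a"
    by (rule differentiableI, rule d) (simp add: \<open>0 < r\<close>)
qed

lemma real_analytic_on_imp_isCont:
  assumes "real_analytic_on h S" "a \<in> S"
  shows "isCont h a"
proof -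
  have "isCont (\<lambda>x. h x \<bullet> b) a" if "b \<in> Basis" for b
    using assms that unfolding real_analytic_on_def
    by (intro differentiable_imp_continuous_within real_analytic_at_imp_differentiable) auto
  then show ?thesis
    unfolding isCont_def by (subst tendsto_componentwise_iff) blast
qed

lemma real_analytic_at_frechet_derivative:
  assumes "\<And>x. real_analytic_at h x" and b: "b \<in> Basis"
  shows "real_analytic_at (\<lambda>x. frechet_derivative h (at x) b) a"
proof -
  obtain r g where r: "0 < r" and g: "\<And>b. b \<in> Basis \<Longrightarrow> real_analytic_at (g b) a"
    and d: "\<And>x. x \<in> ball a r \<Longrightarrow> (h has_derivative (\<lambda>v. \<Sum>b\<in>Basis. (v \<bullet> b) * g b x)) (at x)"
    using real_analytic_at_partials[OF assms(1)[of a]] by blast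
  have "frechet_derivative h (at x) b = g b x" if "x \<in> ball a r" for x
  proof -
    have "frechet_derivative h (at x) b = (\<Sum>b'\<in>Basis. (b \<bullet> b') * g b' x)"
      unfolding frechet_derivative_at[OF d[OF that], symmetric] ..
    also have "\<dots> = (\<Sum>b'\<in>Basis. if b = b' then g b' x else 0)"
      by (rule sum.cong) (auto simp: inner_Basis b)
    finally show ?thesis using b by simp
  qed
  then show ?thesis
    by (rule real_analytic_at_cong[OF g[OF b] r])
qed

section \<open>An algebra of functions closed under differentiation\<close>

text \<open>Closing the pullbacks of analytic functions under sums and products formally avoids having to
  multiply multivariate power series; directional derivatives stay inside by the Leibniz rule.\<close>

inductive pullback_algebra ::
    "('z::euclidean_space \<Rightarrow> 'a::euclidean_space) \<Rightarrow> ('z \<Rightarrow> real) \<Rightarrow> bool"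
  for L :: "'z \<Rightarrow> 'a" where
  pull: "(\<And>a. real_analytic_at f a) \<Longrightarrow> pullback_algebra L (\<lambda>z. f (L z))"
| const: "pullback_algebra L (\<lambda>z. c)"
| coord: "pullback_algebra L (\<lambda>z. z \<bullet> b)"
| add: "pullback_algebra L f \<Longrightarrow> pullback_algebra L g \<Longrightarrow> pullback_algebra L (\<lambda>z. f z + g z)"
| mult: "pullback_algebra L f \<Longrightarrow> pullback_algebra L g \<Longrightarrow> pullback_algebra L (\<lambda>z. f z * g z)"

lemma pullback_algebra_sum:
  "(\<And>i. i \<in> A \<Longrightarrow> pullback_algebra L (f i)) \<Longrightarrow> pullback_algebra L (\<lambda>z. \<Sum>i\<in>A. f i z)"
  by (induction A rule: infinite_finite_induct)
     (auto intro: pullback_algebra.const pullback_algebra.add)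

lemma pullback_algebra_uminus:
  assumes "pullback_algebra L f"
  shows "pullback_algebra L (\<lambda>z. - f z)"
  using pullback_algebra.mult[OF pullback_algebra.const[of L "-1"] assms] by simp

lemma pullback_algebra_diff:
  assumes "pullback_algebra L f" and "pullback_algebra L g"
  shows "pullback_algebra L (\<lambda>z. f z - g z)"
  using pullback_algebra.add[OF assms(1) pullback_algebra_uminus[OF assms(2)]] by simp

lemma frechet_derivative_basis_expansion:
  fixes f :: "'a::euclidean_space \<Rightarrow> real"
  assumes "f differentiable (at y)"
  shows "frechet_derivative f (at y) w = (\<Sum>b\<in>Basis. (w \<bullet> b) * frechet_derivative f (at y) b)"
proof -
  have lin: "linear (frechet_derivative f (at y))"
    using assms by (rule linear_frechet_derivative)
  have "frechet_derivative f (at y) w = frechet_derivative f (at y) (\<Sum>b\<in>Basis. (w \<bullet> b) *\<^sub>R b)"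
    by (simp only: euclidean_representation)
  also have "\<dots> = (\<Sum>b\<in>Basis. (w \<bullet> b) * frechet_derivative f (at y) b)"
    using linear_scale[OF lin] by (simp only: linear_sum[OF lin] real_scaleR_def)
  finally show ?thesis .
qed

text \<open>Induction over the generation of the algebra. For a pullback, linearity of
  \<open>L\<close> makes the direction \<open>L v\<close> independent of the point, so the chain
  rule gives a constant-coefficient combination of pulled-back analytic partials.\<close>

lemma pullback_algebra_closed_deriv:
  assumes L: "bounded_linear L" and f: "pullback_algebra L f"
  shows "f differentiable (at z) \<and> pullback_algebra L (\<lambda>z. frechet_derivative f (at z) v)"
  using f
proof (induction arbitrary: z)
  case (pull f)
  have "(f has_derivative frechet_derivative f (at y)) (at y)" for y
    using real_analytic_at_imp_differentiable[OF pull] frechet_derivative_works by blast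
  then have d: "((\<lambda>z. f (L z)) has_derivative (\<lambda>v. frechet_derivative f (at (L z)) (L v))) (at z)" for z
    by (rule has_derivative_compose[OF bounded_linear_imp_has_derivative[OF L]])
  have "frechet_derivative f (at y) w = (\<Sum>b\<in>Basis. (w \<bullet> b) * frechet_derivative f (at y) b)" for y w
    by (rule frechet_derivative_basis_expansion[OF real_analytic_at_imp_differentiable[OF pull]])
  then have eq: "frechet_derivative (\<lambda>z. f (L z)) (at z) v
      = (\<Sum>b\<in>Basis. (L v \<bullet> b) * frechet_derivative f (at (L z)) b)" for z
    using frechet_derivative_at[OF d, symmetric] by metis
  show ?case
    unfolding eq
  proof (intro conjI pullback_algebra_sum pullback_algebra.mult pullback_algebra.const)
    show "(\<lambda>z. f (L z)) differentiable at z" using d by (rule differentiableI)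
    show "pullback_algebra L (\<lambda>z. frechet_derivative f (at (L z)) b)" if "b \<in> Basis" for b
      by (rule pullback_algebra.pull) (intro real_analytic_at_frechet_derivative pull that)
  qed
next
  case (const c)
  then show ?case by (simp add: pullback_algebra.const)
next
  case (coord b)
  have d: "((\<lambda>z. z \<bullet> b) has_derivative (\<lambda>v. v \<bullet> b)) (at z)" for z
    by (rule bounded_linear_imp_has_derivative) (rule bounded_linear_inner_left)
  have "pullback_algebra L (\<lambda>z. frechet_derivative (\<lambda>z. z \<bullet> b) (at z) v)"
    unfolding frechet_derivative_at[OF d, symmetric] by (rule pullback_algebra.const)
  with differentiableI[OF d] show ?case by blast
next
  case (add f g)
  have d: "((\<lambda>z. f z + g z) has_derivative
      (\<lambda>v. frechet_derivative f (at z) v + frechet_derivative g (at z) v)) (at z)" for z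
    using add.IH by (intro has_derivative_add) (simp_all only: frechet_derivative_works[symmetric])
  have "pullback_algebra L (\<lambda>z. frechet_derivative (\<lambda>z. f z + g z) (at z) v)"
    unfolding frechet_derivative_at[OF d, symmetric]
    using add.IH by (intro pullback_algebra.add) simp_all
  with differentiableI[OF d] show ?case by blast
next
  case (mult f g)
  have d: "((\<lambda>z. f z * g z) has_derivative
      (\<lambda>v. f z * frechet_derivative g (at z) v + frechet_derivative f (at z) v * g z)) (at z)" for z
    using mult.IH by (intro has_derivative_mult) (simp_all only: frechet_derivative_works[symmetric])
  have "pullback_algebra L (\<lambda>z. frechet_derivative (\<lambda>z. f z * g z) (at z) v)"
    unfolding frechet_derivative_at[OF d, symmetric]
    using mult.IH mult.hyps by (intro pullback_algebra.add pullback_algebra.mult) simp_all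
  with differentiableI[OF d] show ?case by blast
qed

section \<open>Derivatives of the switching function\<close>

text \<open>In a phase point \<open>z = (X, Q)\<close> the original state is
  \<open>snd (fst z)\<close>, the only argument of the analytic problem data. Costates enter through
  the coordinate functions of \<open>z\<close>.\<close>

abbreviation phase_algebra :: "('n::finite aug \<times> 'n aug \<Rightarrow> real) \<Rightarrow> bool" where
  "phase_algebra \<equiv> pullback_algebra (\<lambda>z. snd (fst z))"

lemma phase_algebra_differentiable: "phase_algebra f \<Longrightarrow> f differentiable (at z)"
  and phase_algebra_deriv: "phase_algebra f \<Longrightarrow> phase_algebra (\<lambda>z. frechet_derivative f (at z) v)"
  using pullback_algebra_closed_deriv[OF bounded_linear_compose[OF bounded_linear_snd bounded_linear_fst]]
  by blast+

lemma phase_algebra_continuous_on: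
  assumes "phase_algebra f" and "continuous_on S z"
  shows "continuous_on S (\<lambda>t. f (z t))"
proof -
  have "continuous_on UNIV f"
    using phase_algebra_differentiable[OF assms(1)]
    by (intro continuous_at_imp_continuous_on ballI differentiable_imp_continuous_within)
  then show ?thesis
    using continuous_on_compose2[OF _ assms(2)] by blast
qed

lemma differentiable_vec:
  fixes g :: "'a::euclidean_space \<Rightarrow> real ^ 'm"
  assumes "\<And>i. (\<lambda>z. g z $ i) differentiable (at z)"
  shows "g differentiable (at z)"
    and "frechet_derivative g (at z) v $ i = frechet_derivative (\<lambda>z. g z $ i) (at z) v"
proof -
  let ?D = "\<lambda>v. \<chi> i. frechet_derivative (\<lambda>z. g z $ i) (at z) v"
  have D: "(g has_derivative ?D) (at z)"
    unfolding has_derivative_componentwise_within[of g]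
    using assms by (auto simp: Basis_vec_def inner_axis frechet_derivative_works[symmetric])
  show "g differentiable (at z)" using D by (rule differentiableI)
  show "frechet_derivative g (at z) v $ i = frechet_derivative (\<lambda>z. g z $ i) (at z) v"
    unfolding frechet_derivative_at[OF D, symmetric] by simp
qed

section \<open>Gradients and the Hamiltonian vector field\<close>

lemma grad_eqI: "GDERIV h x :> D \<Longrightarrow> grad h x = D"
  unfolding grad_def
proof (rule the_equality)
  fix E assume "GDERIV h x :> D" "GDERIV h x :> E"
  then have "(\<lambda>v. v \<bullet> D) = (\<lambda>v. v \<bullet> E)"
    unfolding gderiv_def by (rule has_derivative_unique)
  then show "E = D" by (metis vector_eq_ldot)
qed

lemma has_derivative_grad:
  fixes h :: "'a::euclidean_space \<Rightarrow> real"
  assumes "h differentiable (at x)"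
  shows "(h has_derivative (\<lambda>v. v \<bullet> grad h x)) (at x)"
proof -
  define D where "D = (\<Sum>b\<in>Basis. frechet_derivative h (at x) b *\<^sub>R b)"
  have "v \<bullet> D = frechet_derivative h (at x) v" for v
    unfolding frechet_derivative_basis_expansion[OF assms, of v]
    by (simp add: D_def inner_sum_right mult.commute)
  then have "GDERIV h x :> D"
    using assms by (simp add: gderiv_def frechet_derivative_works)
  with grad_eqI[OF this] show ?thesis by (simp add: gderiv_def)
qed

lemma phase_algebra_aug:
  fixes f :: "real ^ 'n \<Rightarrow> real ^ 'n::finite"
  assumes "real_analytic_on c UNIV" and "real_analytic_on f UNIV"
  shows "phase_algebra (\<lambda>z. snd z \<bullet> (c (snd (fst z)), f (snd (fst z))))"
proof -
  have c: "phase_algebra (\<lambda>z. c (snd (fst z)))"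
    using assms(1) by (intro pullback_algebra.pull) (simp add: real_analytic_on_def)
  have f: "phase_algebra (\<lambda>z. f (snd (fst z)) \<bullet> b)" if "b \<in> Basis" for b
    using assms(2) that
    by (intro pullback_algebra.pull[where f="\<lambda>x. f x \<bullet> b"]) (simp add: real_analytic_on_def)
  \<comment> \<open>Inner products with \<open>(0, (1, 0))\<close> and \<open>(0, (0, b))\<close>
    read off the costate of the cost and the remaining costate coordinates.\<close>
  have "phase_algebra (\<lambda>z. (z \<bullet> (0, (1, 0))) * c (snd (fst z)) +
      (\<Sum>b\<in>Basis. (z \<bullet> (0, (0, b))) * (f (snd (fst z)) \<bullet> b)))"
    by (intro pullback_algebra.add pullback_algebra.mult pullback_algebra_sum pullback_algebra.coord c f)
  also have "(\<lambda>z :: 'n aug \<times> 'n aug. (z \<bullet> (0, (1, 0))) * c (snd (fst z)) +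
      (\<Sum>b\<in>Basis. (z \<bullet> (0, (0, b))) * (f (snd (fst z)) \<bullet> b)))
      = (\<lambda>z. snd z \<bullet> (c (snd (fst z)), f (snd (fst z))))"
  proof
    fix z :: "'n aug \<times> 'n aug"
    show "(z \<bullet> (0, (1, 0))) * c (snd (fst z)) + (\<Sum>b\<in>Basis. (z \<bullet> (0, (0, b))) * (f (snd (fst z)) \<bullet> b))
      = snd z \<bullet> (c (snd (fst z)), f (snd (fst z)))"
      using euclidean_inner[of "snd (snd z)" "f (snd (fst z))"] by (simp add: inner_prod_def)
  qed
  finally show ?thesis .
qed

lemma phase_algebra_switching:
  assumes "analytic_problem P"
  shows "phase_algebra (\<lambda>z. switching P z $ i)"
  using phase_algebra_aug[of "cost_ctrl P i" "ctrl P i"] assms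
  by (simp add: switching_def aug_ctrl_def analytic_problem_def)

lemma aug_hamiltonian_eq:
  "aug_hamiltonian P (fst z) (snd z) w = aug_hamiltonian P (fst z) (snd z) 0 + (\<Sum>i\<in>UNIV. w $ i * switching P z $ i)"
  by (simp add: aug_hamiltonian_def switching_def mult.commute)

lemma phase_algebra_hamiltonian:
  assumes "analytic_problem P"
  shows "phase_algebra (\<lambda>z. aug_hamiltonian P (fst z) (snd z) w)"
proof -
  have "phase_algebra (\<lambda>z. aug_hamiltonian P (fst z) (snd z) 0)"
    using phase_algebra_aug[of "cost_drift P" "drift P"] assms
    by (simp add: aug_hamiltonian_def aug_drift_def analytic_problem_def)
  then show ?thesis
    unfolding aug_hamiltonian_eq[of P _ w]
    by (intro pullback_algebra.add pullback_algebra_sum pullback_algebra.mult pullback_algebra.const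
        phase_algebra_switching assms)
qed

text \<open>The component along \<open>e\<close> of the Hamiltonian vector field of
  \<open>h\<close>, that is of the costate derivative paired with minus the state derivative. Hence
  \<open>fst e\<close> and \<open>snd e\<close> change places.\<close>

definition symplectic_gradient :: "('n::finite aug \<times> 'n aug \<Rightarrow> real) \<Rightarrow> 'n aug \<times> 'n aug \<Rightarrow>
    'n aug \<times> 'n aug \<Rightarrow> real" where
  "symplectic_gradient h z e =
     frechet_derivative h (at z) (0, fst e) - frechet_derivative h (at z) (snd e, 0)"

lemma phase_algebra_symplectic_gradient:
  "phase_algebra h \<Longrightarrow> phase_algebra (\<lambda>z. symplectic_gradient h z e)"
  unfolding symplectic_gradient_def by (intro pullback_algebra_diff phase_algebra_deriv)

text \<open>Both gradients are restrictions of one total derivative to slices with state or costate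
  fixed. This trades the definite descriptions in \<open>grad\<close> for derivatives that stay in
  the phase algebra.\<close>

lemma hamiltonian_field_inner:
  assumes "analytic_problem P"
  shows "hamiltonian_field P z w \<bullet> e
    = symplectic_gradient (\<lambda>z. aug_hamiltonian P (fst z) (snd z) w) z e"
proof -
  let ?h = "\<lambda>z. aug_hamiltonian P (fst z) (snd z) w"
  let ?D = "frechet_derivative ?h (at z)"
  obtain X Q where z: "z = (X, Q)" by (cases z)
  have D: "(?h has_derivative ?D) (at (X, Q))"
    using phase_algebra_differentiable[OF phase_algebra_hamiltonian[OF assms]] z
    by (simp only: frechet_derivative_works)
  have "((\<lambda>Q. ?h (X, Q)) has_derivative (\<lambda>v. ?D (0, v))) (at Q)"
    by (rule has_derivative_compose[where f="Pair X" and g="?h", OF _ D]) (auto intro!: derivative_eq_intros)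
  then have Q: "((\<lambda>Q. aug_hamiltonian P X Q w) has_derivative (\<lambda>v. ?D (0, v))) (at Q)"
    by simp
  have "((\<lambda>X. ?h (X, Q)) has_derivative (\<lambda>v. ?D (v, 0))) (at X)"
    by (rule has_derivative_compose[where f="\<lambda>X. (X, Q)" and g="?h", OF _ D]) (auto intro!: derivative_eq_intros)
  then have X: "((\<lambda>X. aug_hamiltonian P X Q w) has_derivative (\<lambda>v. ?D (v, 0))) (at X)"
    by simp
  have "v \<bullet> grad (\<lambda>Q. aug_hamiltonian P X Q w) Q = ?D (0, v)" for v
    using has_derivative_unique[OF has_derivative_grad[OF differentiableI[OF Q]] Q] by meson
  moreover have "v \<bullet> grad (\<lambda>X. aug_hamiltonian P X Q w) X = ?D (v, 0)" for v
    using has_derivative_unique[OF has_derivative_grad[OF differentiableI[OF X]] X] by meson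
  ultimately show ?thesis
    unfolding z symplectic_gradient_def hamiltonian_field_def
    by (cases e) (simp add: inner_commute)
qed

text \<open>The Hamiltonian is affine in the control with the switching functions as slopes, and the
  symplectic gradient is linear in the Hamiltonian.\<close>

lemma hamiltonian_field_affine:
  assumes "analytic_problem P"
  shows "hamiltonian_field P z w \<bullet> e = hamiltonian_field P z 0 \<bullet> e +
    (\<Sum>i\<in>UNIV. w $ i * symplectic_gradient (\<lambda>z. switching P z $ i) z e)"
proof -
  let ?h = "\<lambda>w z. aug_hamiltonian P (fst z) (snd z) w"
  let ?\<phi> = "\<lambda>i z. switching P z $ i"
  have h: "(?h 0 has_derivative frechet_derivative (?h 0) (at z)) (at z)"
    using phase_algebra_differentiable[OF phase_algebra_hamiltonian[OF assms]]
    by (simp only: frechet_derivative_works)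
  have \<phi>: "(?\<phi> i has_derivative frechet_derivative (?\<phi> i) (at z)) (at z)" for i
    using phase_algebra_differentiable[OF phase_algebra_switching[OF assms]]
    by (simp only: frechet_derivative_works)
  have "((\<lambda>z. ?h 0 z + (\<Sum>i\<in>UNIV. w $ i * ?\<phi> i z)) has_derivative
      (\<lambda>v. frechet_derivative (?h 0) (at z) v + (\<Sum>i\<in>UNIV. w $ i * frechet_derivative (?\<phi> i) (at z) v))) (at z)"
    by (intro has_derivative_add has_derivative_sum has_derivative_mult_right h \<phi>)
  then have "(?h w has_derivative
      (\<lambda>v. frechet_derivative (?h 0) (at z) v + (\<Sum>i\<in>UNIV. w $ i * frechet_derivative (?\<phi> i) (at z) v))) (at z)"
    by (simp only: aug_hamiltonian_eq[of P _ w])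
  note D = frechet_derivative_at[OF this, symmetric]
  show ?thesis
    unfolding hamiltonian_field_inner[OF assms] symplectic_gradient_def D
    by (simp add: sum_subtractf right_diff_distrib)
qed

text \<open>The phase algebra gives continuity only for a frozen control value. The affine form
  separates phase point and control, so both may vary with time.\<close>

lemma continuous_on_hamiltonian_field:
  fixes P :: "('n::finite, 'm::finite) affine_problem" and S :: "real set"
  assumes "analytic_problem P" and "continuous_on S z" and "continuous_on S v"
  shows "continuous_on S (\<lambda>t. hamiltonian_field P (z t) (v t))"
proof (subst continuous_on_componentwise, intro ballI)
  fix e :: "'n aug \<times> 'n aug"
  have "continuous_on S (\<lambda>t. hamiltonian_field P (z t) 0 \<bullet> e)"
    unfolding hamiltonian_field_inner[OF assms(1)]
    by (rule phase_algebra_continuous_on[OF _ assms(2)])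
       (intro phase_algebra_symplectic_gradient phase_algebra_hamiltonian assms)
  moreover have "continuous_on S (\<lambda>t. symplectic_gradient (\<lambda>z. switching P z $ i) (z t) e)" for i
    by (rule phase_algebra_continuous_on[OF _ assms(2)])
       (intro phase_algebra_symplectic_gradient phase_algebra_switching assms)
  ultimately show "continuous_on S (\<lambda>t. hamiltonian_field P (z t) (v t) \<bullet> e)"
    unfolding hamiltonian_field_affine[OF assms(1), of _ "v _"]
    by (intro continuous_on_add continuous_on_sum continuous_on_mult continuous_on_component assms(3))
qed

section \<open>Iterated derivatives up to the intrinsic order\<close>

lemma phase_algebra_switching_deriv:
  assumes "analytic_problem P"
  shows "phase_algebra (\<lambda>z. switching_deriv P k z w $ i)"
proof (induction k arbitrary: i)
  case 0
  show ?case using phase_algebra_switching[OF assms] by simp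
next
  case (Suc k)
  let ?g = "\<lambda>i z. switching_deriv P k z w $ i"
  have diff: "?g i differentiable (at z)" for i z
    by (rule phase_algebra_differentiable[OF Suc])
  have eq: "switching_deriv P (Suc k) z w $ i
      = (\<Sum>e\<in>Basis. (hamiltonian_field P z w \<bullet> e) * frechet_derivative (?g i) (at z) e)" for z
    by (simp add: differentiable_vec(2)[OF diff] flip: frechet_derivative_basis_expansion[OF diff])
  show ?case
    unfolding eq hamiltonian_field_inner[OF assms]
    by (intro pullback_algebra_sum pullback_algebra.mult phase_algebra_symplectic_gradient
        phase_algebra_hamiltonian phase_algebra_deriv Suc assms)
qed

lemma switching_deriv_Suc_nth:
  assumes "analytic_problem P"
  shows "switching_deriv P (Suc k) z w $ i
    = frechet_derivative (\<lambda>z. switching_deriv P k z w $ i) (at z) (hamiltonian_field P z w)"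
  using differentiable_vec(2)[of "\<lambda>z. switching_deriv P k z w" z]
    phase_algebra_differentiable[OF phase_algebra_switching_deriv[OF assms]] by simp

lemma B_coef_0: "B_coef P 0 z = 0"
proof -
  have "switching_deriv P 0 z = (\<lambda>w. switching P z)" by (rule ext) simp
  then show ?thesis by (simp add: B_coef_def jacobian_def matrix_def vec_eq_iff)
qed

text \<open>If the \<open>k\<close>-th derivative of the switching function does not see the control, the next one is
  affine in it because \<^const>\<open>hamiltonian_field\<close> is.\<close>

lemma switching_deriv_affine:
  fixes P :: "('n::finite, 'm::finite) affine_problem"
  assumes P: "analytic_problem P" and indep: "\<And>z w. switching_deriv P k z w = A_coef P k z"
  shows "switching_deriv P (Suc k) z w = A_coef P (Suc k) z + B_coef P (Suc k) z *v w"
proof -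
  let ?g = "\<lambda>i z. A_coef P k z $ i"
  have diff: "?g i differentiable (at z)" for i
    unfolding A_coef_def by (intro phase_algebra_differentiable phase_algebra_switching_deriv P)
  \<comment> \<open>The control-dependent part of the next derivative. It is linear in
    \<open>w\<close>, so its matrix is the Jacobian that defines \<open>B_coef\<close>.\<close>
  define C where "C = (\<lambda>w::real ^ 'm. \<chi> i. \<Sum>e\<in>Basis.
    (\<Sum>j\<in>UNIV. w $ j * symplectic_gradient (\<lambda>z. switching P z $ j) z e) * frechet_derivative (?g i) (at z) e)"
  have eq: "switching_deriv P (Suc k) z w = A_coef P (Suc k) z + C w" for w
  proof -
    have *: "switching_deriv P (Suc k) z w $ i
      = (\<Sum>e\<in>Basis. (hamiltonian_field P z w \<bullet> e) * frechet_derivative (?g i) (at z) e)" for w i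
      unfolding switching_deriv_Suc_nth[OF P] indep by (rule frechet_derivative_basis_expansion[OF diff])
    show ?thesis
      unfolding vec_eq_iff vector_add_component A_coef_def[of P "Suc k"] *
        hamiltonian_field_affine[OF P, of z w]
      by (simp add: C_def sum.distrib distrib_right)
  qed
  have "linear C"
    by (rule linearI) (simp_all add: C_def vec_eq_iff sum.distrib distrib_right sum_distrib_left sum_distrib_right mult_ac)
  then have "(C has_derivative C) (at 0)"
    by (rule linear_imp_has_derivative)
  then have "((\<lambda>w. A_coef P (Suc k) z + C w) has_derivative C) (at 0)"
    using has_derivative_add[OF has_derivative_const] by fastforce
  then have "frechet_derivative (switching_deriv P (Suc k) z) (at 0) = C"
    using frechet_derivative_at eq by (metis (no_types, lifting) ext)
  then have "B_coef P (Suc k) z = matrix C"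
    by (simp only: B_coef_def jacobian_def)
  then have "B_coef P (Suc k) z *v w = C w"
    using \<open>linear C\<close> by (simp add: matrix_works linear_matrix_vector_mul_eq)
  with eq show ?thesis by simp
qed

text \<open>Induction with the affine formula: each new control coefficient vanishes by the
  minimality in the definition of the order, so the next derivative is again a function of state and
  costate alone.\<close>

lemma switching_deriv_below_order:
  assumes P: "analytic_problem P" and q: "has_intrinsic_order P q" and "k < 2 * q"
  shows "switching_deriv P k z w = A_coef P k z"
  using \<open>k < 2 * q\<close>
proof (induction k arbitrary: z w)
  case 0
  show ?case by (simp add: A_coef_def)
next
  case (Suc k)
  then have "B_coef P (Suc k) z = 0" using q unfolding has_intrinsic_order_def by blast
  with switching_deriv_affine[OF P Suc.IH, of z w] Suc.prems show ?case
    by (simp del: switching_deriv.simps)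
qed

text \<open>The switching function itself does not contain the control. Positivity lets
  \<open>2 * q\<close> be written as a successor, to which the affine formula applies.\<close>

lemma intrinsic_order_pos: "has_intrinsic_order P q \<Longrightarrow> 0 < q"
  by (rule ccontr) (auto simp: has_intrinsic_order_def B_coef_0)

lemma switching_deriv_at_order:
  assumes P: "analytic_problem P" and q: "has_intrinsic_order P q"
  shows "switching_deriv P (2 * q) z w = A_coef P (2 * q) z + B_coef P (2 * q) z *v w"
proof -
  obtain k where k: "2 * q = Suc k"
    using intrinsic_order_pos[OF q] by (cases "2 * q") auto
  show ?thesis
    unfolding k using switching_deriv_below_order[OF P q] k by (intro switching_deriv_affine P) simp
qed

text \<open>The recursion for \<open>switching_deriv\<close> differentiates with the control value
  frozen. Under \<open>indep\<close> the differentiated function does not see the control, so its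
  variation in time adds no term and the plain chain rule suffices.\<close>

lemma A_coef_has_derivative:
  assumes P: "analytic_problem P" and indep: "\<And>z w. switching_deriv P k z w = A_coef P k z"
    and z: "(z has_vector_derivative hamiltonian_field P (z t) (v t)) (at t)"
  shows "((\<lambda>t. A_coef P k (z t) $ i) has_real_derivative switching_deriv P (Suc k) (z t) (v t) $ i) (at t)"
proof -
  let ?g = "\<lambda>z. A_coef P k z $ i"
  have "?g differentiable (at (z t))"
    unfolding A_coef_def by (intro phase_algebra_differentiable phase_algebra_switching_deriv P)
  then have "(?g has_derivative frechet_derivative ?g (at (z t))) (at (z t) within range z)"
    by (simp add: frechet_derivative_works has_derivative_at_withinI)
  from vector_derivative_diff_chain_within[OF z this]
  show ?thesis
    unfolding switching_deriv_Suc_nth[OF P] indep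
    by (simp add: o_def has_real_derivative_iff_has_vector_derivative)
qed

section \<open>Regularity along extremals\<close>

lemma AE_lebesgue_on_subset:
  assumes "AE t in lebesgue_on S. P t" "J \<subseteq> S" "S \<in> sets lebesgue" "J \<in> sets lebesgue"
  shows "AE t in lebesgue_on J. P t"
  using assms by (auto simp: AE_restrict_space_iff elim!: eventually_mono)

lemma AE_lebesgue_on_negligible:
  assumes "AE t in lebesgue_on S. P t" "S \<in> sets lebesgue"
  shows "negligible {t \<in> S. \<not> P t}"
proof -
  have "AE t in lebesgue. t \<in> S \<longrightarrow> P t"
    using assms by (simp add: AE_restrict_space_iff)
  then obtain N where N: "N \<in> null_sets lebesgue" "{t \<in> space lebesgue. \<not> (t \<in> S \<longrightarrow> P t)} \<subseteq> N"
    unfolding eventually_ae_filter by blast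
  show ?thesis
    by (rule negligible_subset[OF iffD2[OF negligible_iff_null_sets N(1)]]) (use N(2) in auto)
qed

lemma AE_interval_ex:
  fixes a b :: real
  assumes "AE t in lebesgue_on {a<..<b}. P t" "a < b"
  shows "\<exists>t\<in>{a<..<b}. P t"
proof (rule ccontr)
  assume "\<not> ?thesis"
  then have "{t \<in> {a<..<b}. \<not> P t} = {a<..<b}" by auto
  then have "negligible {a<..<b}"
    using AE_lebesgue_on_negligible[OF assms(1)] by simp
  with negligible_interval(2)[of a b] \<open>a < b\<close> show False
    by simp
qed

text \<open>A strict violation at \<open>t\<close> would persist by continuity on an interval to the
  right of \<open>t\<close>, which has positive measure.\<close>

lemma AE_le_imp_le_continuous:
  fixes f g :: "real \<Rightarrow> real"
  assumes ae: "AE t in lebesgue_on {a<..<b}. f t \<le> g t"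
    and f: "continuous_on {a<..<b} f" and g: "continuous_on {a<..<b} g" and t: "t \<in> {a<..<b}"
  shows "f t \<le> g t"
proof (rule ccontr)
  assume "\<not> ?thesis"
  then have "0 < f t - g t" by simp
  have "isCont (\<lambda>t. f t - g t) t"
    using f g t by (intro continuous_intros) (simp_all add: continuous_on_eq_continuous_at)
  then have "\<forall>\<^sub>F s in at t. 0 < f s - g s"
    using order_tendstoD(1)[OF _ \<open>0 < f t - g t\<close>] unfolding isCont_def by blast
  then obtain d where d: "0 < d" "\<And>s. s \<noteq> t \<Longrightarrow> dist s t < d \<Longrightarrow> 0 < f s - g s"
    by (auto simp: eventually_at)
  have "AE s in lebesgue_on {t<..<min b (t + d)}. f s \<le> g s"
    using t by (intro AE_lebesgue_on_subset[OF ae]) auto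
  moreover have "t < min b (t + d)" using t d by simp
  ultimately obtain s where "s \<in> {t<..<min b (t + d)}" "f s \<le> g s"
    using AE_interval_ex by blast
  with d(2)[of s] show False by (simp add: dist_real_def)
qed

text \<open>The integral does not notice null sets, so \<open>g\<close> may be replaced near
  \<open>t\<close> by its continuous representative \<open>G\<close>. The fundamental theorem then
  gives a derivative at every point, not just almost everywhere.\<close>

lemma indefinite_integral_has_vector_derivative:
  fixes y :: "real \<Rightarrow> 'a::euclidean_space"
  assumes int: "g integrable_on {0..T}" and y: "\<And>t. t \<in> {0..T} \<Longrightarrow> y t = c + integral {0..t} g"
    and sub: "{a<..<b} \<subseteq> {0..T}" and G: "continuous_on {a<..<b} G"
    and ae: "AE t in lebesgue_on {a<..<b}. g t = G t" and t: "t \<in> {a<..<b}"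
  shows "(y has_vector_derivative G t) (at t)"
proof -
  \<comment> \<open>The midpoints enclose \<open>t\<close> in a compact interval inside the open one
    where \<open>G\<close> is continuous.\<close>
  define \<alpha> where "\<alpha> = (a + t) / 2"
  define \<beta> where "\<beta> = (t + b) / 2"
  have order: "a < \<alpha>" "\<alpha> < t" "t < \<beta>" "\<beta> < b"
    using t by (auto simp: \<alpha>_def \<beta>_def)
  have Icc: "{\<alpha>..\<beta>} \<subseteq> {a<..<b}" using order by auto
  have in0T: "s \<in> {0..T}" if "s \<in> {\<alpha>..\<beta>}" for s
    using that Icc sub by blast
  have yG: "y s = (c + integral {0..\<alpha>} g) + integral {\<alpha>..s} G" if "s \<in> {\<alpha><..<\<beta>}" for s
  proof -
    have s: "s \<in> {0..T}" and "\<alpha> \<in> {0..T}"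
      using in0T[of s] in0T[of \<alpha>] that order by auto
    have "integral {0..s} g = integral {0..\<alpha>} g + integral {\<alpha>..s} g"
      using that s \<open>\<alpha> \<in> {0..T}\<close>
      by (intro Henstock_Kurzweil_Integration.integral_combine[symmetric] integrable_subinterval_real[OF int]) auto
    also have "integral {\<alpha>..s} g = integral {\<alpha>..s} G"
    proof (rule integral_spike[OF AE_lebesgue_on_negligible[OF ae]])
      show "G r = g r" if "r \<in> {\<alpha>..s} - {t \<in> {a<..<b}. g t \<noteq> G t}" for r
        using that \<open>s \<in> {\<alpha><..<\<beta>}\<close> order by auto
    qed simp
    finally show ?thesis using y[OF s] by simp
  qed
  have "((\<lambda>s. integral {\<alpha>..s} G) has_vector_derivative G t) (at t within {\<alpha>..\<beta>})"
    using order by (intro integral_has_vector_derivative continuous_on_subset[OF G Icc]) auto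
  then have "((\<lambda>s. integral {\<alpha>..s} G) has_vector_derivative G t) (at t)"
    using order by (simp add: at_within_Icc_at)
  then have "((\<lambda>s. (c + integral {0..\<alpha>} g) + integral {\<alpha>..s} G) has_vector_derivative G t) (at t)"
    by (intro has_vector_derivative_eq_rhs[OF has_vector_derivative_add[OF has_vector_derivative_const]]) simp_all
  then show ?thesis
    by (rule has_vector_derivative_transform_within_open[of _ _ _ "{\<alpha><..<\<beta>}"]) (use order yG in auto)
qed

lemma indefinite_integral_continuous:
  fixes y :: "real \<Rightarrow> 'a::euclidean_space"
  assumes "g integrable_on {0..T}" and "\<And>t. t \<in> {0..T} \<Longrightarrow> y t = c + integral {0..t} g"
  shows "continuous_on {0..T} y"
proof -
  have "continuous_on {0..T} (\<lambda>t. c + integral {0..t} g)"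
    by (intro continuous_on_add continuous_on_const indefinite_integral_continuous_1 assms(1))
  then show ?thesis
    by (subst continuous_on_cong[OF refl assms(2)]) auto
qed

section \<open>Extremals as solutions of the augmented Hamiltonian system\<close>

lemma aug_hamiltonian_velocity:
  "aug_hamiltonian P X Q w = Q \<bullet> (running_cost P (snd X) w, velocity P (snd X) w)"
  by (simp add: aug_hamiltonian_def aug_drift_def aug_ctrl_def running_cost_def velocity_def inner_prod_def
      distrib_left distrib_right inner_right_distrib inner_sum_right sum.distrib sum_distrib_left mult_ac)

lemma aug_hamiltonian_lift: "aug_hamiltonian P X (- l, p) w = hamiltonian P l (snd X) p w"
  by (simp add: aug_hamiltonian_velocity hamiltonian_def inner_prod_def)

text \<open>Connects the augmented field with the equations in \<open>pmp_lift\<close>. The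
  accumulated cost does not occur in the Hamiltonian, hence the zero in the costate part, matching
  the constant \<open>- l\<close> in \<open>extremal\<close>.\<close>

lemma hamiltonian_field_lift:
  fixes P :: "('n::finite, 'm::finite) affine_problem"
  assumes P: "analytic_problem P"
  shows "hamiltonian_field P ((c, y), (- l, p)) w
    = ((running_cost P y w, velocity P y w), (0, - grad (\<lambda>y. hamiltonian P l y p w) y))"
proof -
  have 1: "GDERIV (\<lambda>Q. aug_hamiltonian P (c, y) Q w) (- l, p) :> (running_cost P y w, velocity P y w)"
    unfolding aug_hamiltonian_velocity snd_conv gderiv_def
    by (rule bounded_linear_imp_has_derivative) (rule bounded_linear_inner_left)
  let ?e = "\<lambda>y. ((0, y), (- l, p)) :: 'n aug \<times> 'n aug"
  have e: "(?e has_derivative (\<lambda>v. ((0, v), (0, 0)))) (at y)"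
    by (intro has_derivative_Pair has_derivative_const has_derivative_ident)
  have "(\<lambda>z. aug_hamiltonian P (fst z) (snd z) w) differentiable (at (?e y))"
    by (intro phase_algebra_differentiable phase_algebra_hamiltonian P)
  from has_derivative_compose[OF e this[unfolded frechet_derivative_works]]
  have "(\<lambda>y. hamiltonian P l y p w) differentiable (at y)"
    by (simp add: aug_hamiltonian_lift differentiableI)
  from has_derivative_grad[OF this]
  have "((\<lambda>y. hamiltonian P l y p w) has_derivative (\<lambda>v. v \<bullet> grad (\<lambda>y. hamiltonian P l y p w) y))
      (at (snd (c, y)))" by simp
  from has_derivative_compose[OF bounded_linear_imp_has_derivative[OF bounded_linear_snd] this]
  have 2: "GDERIV (\<lambda>X. aug_hamiltonian P X (- l, p) w) (c, y) :> (0, grad (\<lambda>y. hamiltonian P l y p w) y)"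
    unfolding aug_hamiltonian_lift gderiv_def by (simp add: inner_prod_def)
  show ?thesis
    by (simp add: hamiltonian_field_def grad_eqI[OF 1] grad_eqI[OF 2])
qed

locale extremal_lift =
  fixes P :: "('n::finite, 'm::finite) affine_problem" and T l :: real
    and u :: "real \<Rightarrow> real ^ 'm" and x p :: "real \<Rightarrow> real ^ 'n"
  assumes P: "analytic_problem P" and adm: "admissible P T u x" and lift: "pmp_lift P T u x l p"
begin

abbreviation z :: "real \<Rightarrow> 'n aug \<times> 'n aug" where "z \<equiv> extremal P u x l p"

lemma x_integral:
  "(\<lambda>t. velocity P (x t) (u t)) integrable_on {0..T}"
  "t \<in> {0..T} \<Longrightarrow> x t = x 0 + integral {0..t} (\<lambda>t. velocity P (x t) (u t))"
  using adm by (auto simp: admissible_def ae_derivative_on_def set_lebesgue_integral_eq_integral(1))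

lemma p_integral:
  "(\<lambda>t. - grad (\<lambda>y. hamiltonian P l y (p t) (u t)) (x t)) integrable_on {0..T}"
  "t \<in> {0..T} \<Longrightarrow> p t = p 0 + integral {0..t} (\<lambda>t. - grad (\<lambda>y. hamiltonian P l y (p t) (u t)) (x t))"
  using lift unfolding pmp_lift_def ae_derivative_on_def by (blast intro: set_lebesgue_integral_eq_integral(1))+

lemma x_continuous: "continuous_on {0..T} x"
  using x_integral by (rule indefinite_integral_continuous)

lemma p_continuous: "continuous_on {0..T} p"
  using p_integral by (rule indefinite_integral_continuous)

lemma bound_continuous: "continuous_on {0..T} (bound P)"
  using P real_analytic_on_imp_isCont[of "bound P" "{0..}"]
  by (auto simp: analytic_problem_def intro!: continuous_at_imp_continuous_on)

lemma bound_pos: "0 \<le> t \<Longrightarrow> 0 < bound P t"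
  using P by (simp add: analytic_problem_def)

text \<open>Needed for the cost coordinate of the extremal, since \<open>admissible\<close> records
  integrability of the velocity only. The running cost is measurable and dominated by a continuous
  function, because the control lies in the box.\<close>

lemma running_cost_integrable: "(\<lambda>t. running_cost P (x t) (u t)) integrable_on {0..T}"
proof (rule measurable_bounded_by_integrable_imp_integrable)
  have cont: "continuous_on {0..T} (\<lambda>t. h (x t))" if "real_analytic_on h UNIV" for h :: "real ^ 'n \<Rightarrow> real"
    using continuous_on_compose2[OF continuous_at_imp_continuous_on x_continuous, of UNIV h]
      real_analytic_on_imp_isCont[OF that] by blast
  have c0: "continuous_on {0..T} (\<lambda>t. cost_drift P (x t))"
    and c: "continuous_on {0..T} (\<lambda>t. cost_ctrl P i (x t))" for i
    using P by (auto simp: analytic_problem_def intro!: cont)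
  have u: "(\<lambda>t. u t $ i) \<in> borel_measurable (lebesgue_on {0..T})" for i
  proof -
    have "(\<lambda>w::real ^ 'm. w $ i) \<in> borel_measurable borel"
      by (intro borel_measurable_continuous_onI continuous_intros)
    then show ?thesis
      using adm measurable_compose unfolding admissible_def by blast
  qed
  show "(\<lambda>t. running_cost P (x t) (u t)) \<in> borel_measurable (lebesgue_on {0..T})"
    unfolding running_cost_def
    by (intro borel_measurable_add borel_measurable_sum borel_measurable_times u
        continuous_imp_measurable_on_sets_lebesgue c0 c) auto
  show "(\<lambda>t. \<bar>cost_drift P (x t)\<bar> + (\<Sum>i\<in>UNIV. \<bar>cost_ctrl P i (x t)\<bar> * bound P t)) integrable_on {0..T}"
    by (intro integrable_continuous_real continuous_on_add continuous_on_sum continuous_on_mult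
        continuous_on_rabs c0 c bound_continuous)
  show "norm (running_cost P (x t) (u t))
      \<le> \<bar>cost_drift P (x t)\<bar> + (\<Sum>i\<in>UNIV. \<bar>cost_ctrl P i (x t)\<bar> * bound P t)" if "t \<in> {0..T}" for t
  proof -
    have "\<bar>u t $ i\<bar> \<le> bound P t" for i
      using adm that by (simp add: admissible_def control_box_def)
    then have "\<bar>\<Sum>i\<in>UNIV. cost_ctrl P i (x t) * u t $ i\<bar> \<le> (\<Sum>i\<in>UNIV. \<bar>cost_ctrl P i (x t)\<bar> * bound P t)"
      by (intro order_trans[OF sum_abs] sum_mono) (simp add: abs_mult mult_left_mono)
    then show ?thesis
      unfolding running_cost_def real_norm_def by linarith
  qed
qed auto

lemma z_continuous: "continuous_on {0..T} z"
  unfolding extremal_def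
  by (intro continuous_on_Pair continuous_on_const x_continuous p_continuous
      indefinite_integral_continuous_1 running_cost_integrable)

text \<open>Wherever the control has a continuous representative \<open>v\<close>, the integral
  equations for cost, state and costate become a classical differential equation driven by
  \<open>v\<close>.\<close>

lemma z_has_derivative:
  assumes sub: "{a<..<b} \<subseteq> {0..T}" and v: "continuous_on {a<..<b} v"
    and ae: "AE t in lebesgue_on {a<..<b}. v t = u t" and t: "t \<in> {a<..<b}"
  shows "(z has_vector_derivative hamiltonian_field P (z t) (v t)) (at t)"
proof -
  have field: "hamiltonian_field P (z t) w = ((running_cost P (x t) w, velocity P (x t) w),
      (0, - grad (\<lambda>y. hamiltonian P l y (p t) w) (x t)))" for t w
    unfolding extremal_def by (rule hamiltonian_field_lift[OF P])
  have F: "continuous_on {a<..<b} (\<lambda>t. hamiltonian_field P (z t) (v t))"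
    by (intro continuous_on_hamiltonian_field P v continuous_on_subset[OF z_continuous sub])
  have c: "continuous_on {a<..<b} (\<lambda>t. running_cost P (x t) (v t))"
    and x: "continuous_on {a<..<b} (\<lambda>t. velocity P (x t) (v t))"
    and p: "continuous_on {a<..<b} (\<lambda>t. - grad (\<lambda>y. hamiltonian P l y (p t) (v t)) (x t))"
    using continuous_on_fst[OF continuous_on_fst[OF F]] continuous_on_snd[OF continuous_on_fst[OF F]]
      continuous_on_snd[OF continuous_on_snd[OF F]]
    unfolding field fst_conv snd_conv by blast+
  have ae': "AE t in lebesgue_on {a<..<b}. k t (u t) = k t (v t)" for k :: "real \<Rightarrow> real ^ 'm \<Rightarrow> 'c"
    using ae by (rule eventually_mono) simp
  have "((\<lambda>t. integral {0..t} (\<lambda>t. running_cost P (x t) (u t))) has_vector_derivative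
      running_cost P (x t) (v t)) (at t)"
    by (rule indefinite_integral_has_vector_derivative[OF running_cost_integrable _ sub c ae' t, of _ 0]) simp
  moreover have "(x has_vector_derivative velocity P (x t) (v t)) (at t)"
    by (rule indefinite_integral_has_vector_derivative[OF x_integral sub x ae' t])
  moreover have "(p has_vector_derivative - grad (\<lambda>y. hamiltonian P l y (p t) (v t)) (x t)) (at t)"
    by (rule indefinite_integral_has_vector_derivative[OF p_integral sub p ae' t])
  ultimately show ?thesis
    unfolding field unfolding extremal_def
    by (intro has_vector_derivative_Pair has_vector_derivative_const)
qed

text \<open>Maximality over a box decouples into one condition per component. The product form makes
  sense also where the switching function vanishes, and it passes to limits.\<close>

lemma switching_maximum:
  "AE t in lebesgue_on {0..T}. \<forall>i. \<bar>switching P (z t) $ i\<bar> * bound P t \<le> switching P (z t) $ i * u t $ i"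
proof -
  have "AE t in lebesgue_on {0..T}. \<forall>w\<in>control_box P t.
      hamiltonian P l (x t) (p t) w \<le> hamiltonian P l (x t) (p t) (u t)"
    using lift by (auto simp: pmp_lift_def elim: eventually_mono)
  then show ?thesis
  proof (rule AE_mp, intro AE_I2 impI allI)
    fix t i
    assume "t \<in> space (lebesgue_on {0..T})"
      and max: "\<forall>w\<in>control_box P t. hamiltonian P l (x t) (p t) w \<le> hamiltonian P l (x t) (p t) (u t)"
    then have t: "t \<in> {0..T}" by simp
    let ?\<phi> = "\<lambda>i. switching P (z t) $ i"
    have ham: "hamiltonian P l (x t) (p t) w = hamiltonian P l (x t) (p t) 0 + (\<Sum>i\<in>UNIV. w $ i * ?\<phi> i)" for w
      using aug_hamiltonian_eq[of P "z t" w] by (simp add: extremal_def aug_hamiltonian_lift)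
    \<comment> \<open>The competitor replaces only component \<open>i\<close> of \<open>u t\<close>,
      by its extreme value, so all other summands cancel. At a zero of the switching function that
      value is 0, which is still in the box.\<close>
    let ?w = "\<chi> j. if j = i then sgn (?\<phi> i) * bound P t else u t $ j"
    have ubox: "\<bar>u t $ j\<bar> \<le> bound P t" for j
      using adm t by (simp add: admissible_def control_box_def)
    have "?w \<in> control_box P t"
      using ubox bound_pos[of t] t by (auto simp: control_box_def abs_mult abs_sgn_eq)
    with max have "(\<Sum>j\<in>UNIV. ?w $ j * ?\<phi> j) \<le> (\<Sum>j\<in>UNIV. u t $ j * ?\<phi> j)"
      using ham[of ?w] ham[of "u t"] by fastforce
    moreover have "(\<Sum>j\<in>UNIV. g j) = g i + (\<Sum>j\<in>UNIV - {i}. g j)" for g :: "'m \<Rightarrow> real"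
      by (rule sum.remove) auto
    moreover have "(\<Sum>j\<in>UNIV - {i}. ?w $ j * ?\<phi> j) = (\<Sum>j\<in>UNIV - {i}. u t $ j * ?\<phi> j)"
      by (rule sum.cong) auto
    ultimately have "sgn (?\<phi> i) * bound P t * ?\<phi> i \<le> u t $ i * ?\<phi> i"
      by simp
    then show "\<bar>?\<phi> i\<bar> * bound P t \<le> ?\<phi> i * u t $ i"
      by (simp add: abs_sgn mult_ac)
  qed
qed

end

section \<open>Behaviour at the junction\<close>

text \<open>The open segment from a frontier point to an interior point stays inside the interval.
  The sign \<open>\<sigma>\<close> records on which side of \<open>t\<close> this segment
  lies.\<close>

lemma is_interval_side:
  fixes J :: "real set"
  assumes "is_interval J" "interior J \<noteq> {}" "t \<in> frontier J"
  obtains \<sigma> \<delta> where "\<sigma> \<in> {1, -1}" "0 < \<delta>" "\<And>s. s \<in> {0<..<\<delta>} \<Longrightarrow> t + \<sigma> * s \<in> J"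
proof -
  obtain c where c: "c \<in> interior J" using assms(2) by blast
  have t: "t \<in> closure J" "t \<notin> interior J" using assms(3) by (auto simp: frontier_def)
  have "open_segment c t \<subseteq> J"
    using in_interior_closure_convex_segment[OF is_interval_convex[OF assms(1)] c t(1)] interior_subset by blast
  moreover have "c \<noteq> t" using c t by auto
  ultimately show thesis
    using that[of 1 "c - t"] that[of "-1" "t - c"]
    by (cases "c < t") (force simp: open_segment_eq_real_ivl)+
qed

text \<open>Parametrizing a one-sided neighbourhood by \<open>s > 0\<close> with a sign lets left
  and right be treated by the same argument. The point \<open>t\<close> itself is excluded.\<close>

definition side :: "real \<Rightarrow> real \<Rightarrow> real \<Rightarrow> real set" where
  "side t \<delta> \<sigma> = (\<lambda>s. t + \<sigma> * s) ` {0<..<\<delta>}"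

lemma side_interval:
  assumes "\<sigma> \<in> {1, -1}" "0 < \<delta>"
  obtains a b where "a < b" "side t \<delta> \<sigma> = {a<..<b}" "t \<in> {a..b}"
proof (cases "\<sigma> = 1")
  case True
  have "side t \<delta> \<sigma> = {t<..<t + \<delta>}"
    by (auto simp: side_def True image_iff intro!: bexI[of _ "_ - t"])
  then show thesis by (rule that[rotated]) (use assms in auto)
next
  case False
  then have "\<sigma> = -1" using assms by simp
  have "side t \<delta> \<sigma> = {t - \<delta><..<t}"
    by (auto simp: side_def \<open>\<sigma> = -1\<close> image_iff intro!: bexI[of _ "t - _"])
  then show thesis by (rule that[rotated]) (use assms in auto)
qed

text \<open>A function whose first nonzero one-sided derivative at 0 is negative is negative just to
  the right of 0. By induction the first derivative \<open>d 1\<close> is negative there, so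
  \<open>d 0\<close> decreases strictly from its value 0.\<close>

lemma one_sided_derivatives_negative:
  fixes d :: "nat \<Rightarrow> real \<Rightarrow> real"
  assumes "0 < \<delta>" and "\<And>k. k \<le> n \<Longrightarrow> continuous_on {0..<\<delta>} (d k)"
    and "\<And>k s. k < n \<Longrightarrow> s \<in> {0<..<\<delta>} \<Longrightarrow> (d k has_real_derivative d (Suc k) s) (at s)"
    and "\<And>k. k < n \<Longrightarrow> d k 0 = 0" and "d n 0 < 0"
  shows "\<exists>\<epsilon>>0. \<epsilon> \<le> \<delta> \<and> (\<forall>s\<in>{0<..<\<epsilon>}. d 0 s < 0)"
  using assms
proof (induction n arbitrary: d)
  case 0
  have "(d 0 \<longlongrightarrow> d 0 0) (at 0 within {0..<\<delta>})"
    using 0(2)[of 0] \<open>0 < \<delta>\<close> by (simp add: continuous_on_def)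
  then have "\<forall>\<^sub>F s in at 0 within {0..<\<delta>}. d 0 s < 0"
    using 0(5) by (rule order_tendstoD(2))
  then obtain \<eta> where "0 < \<eta>" "\<And>s. s \<in> {0..<\<delta>} \<Longrightarrow> s \<noteq> 0 \<Longrightarrow> dist s 0 < \<eta> \<Longrightarrow> d 0 s < 0"
    unfolding eventually_at by blast
  then show ?case
    using \<open>0 < \<delta>\<close> by (intro exI[of _ "min \<eta> \<delta>"]) (auto simp: dist_real_def)
next
  case (Suc n)
  have "\<exists>\<epsilon>>0. \<epsilon> \<le> \<delta> \<and> (\<forall>s\<in>{0<..<\<epsilon>}. d (Suc 0) s < 0)"
    by (rule Suc.IH[of "\<lambda>k. d (Suc k)"]) (use Suc.prems in auto)
  then obtain \<epsilon> where \<epsilon>: "0 < \<epsilon>" "\<epsilon> \<le> \<delta>" "\<And>s. s \<in> {0<..<\<epsilon>} \<Longrightarrow> d (Suc 0) s < 0"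
    by blast
  have "d 0 s < 0" if "s \<in> {0<..<\<epsilon>}" for s
  proof -
    have "d 0 s < d 0 0"
    proof (rule DERIV_neg_imp_decreasing_open[where f="d 0"])
      show "0 < s" using that by simp
      show "\<exists>y. DERIV (d 0) r :> y \<and> y < 0" if "0 < r" "r < s" for r
        using that \<open>s \<in> {0<..<\<epsilon>}\<close> \<epsilon> Suc.prems(3)[of 0 r] by (intro exI[of _ "d (Suc 0) r"]) auto
      show "continuous_on {0..s} (d 0)"
        using that \<epsilon> by (intro continuous_on_subset[OF Suc.prems(2)[of 0]]) auto
    qed
    then show ?thesis using Suc.prems(4)[of 0] by simp
  qed
  with \<epsilon> show ?case by blast
qed

lemma continuous_nonzero_sgn_eq:
  fixes f :: "real \<Rightarrow> real"
  assumes f: "continuous_on {a<..<b} f" and nz: "\<And>t. t \<in> {a<..<b} \<Longrightarrow> f t \<noteq> 0"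
    and "s \<in> {a<..<b}" "t \<in> {a<..<b}"
  shows "sgn (f s) = sgn (f t)"
proof (rule ccontr)
  assume ne: "sgn (f s) \<noteq> sgn (f t)"
  have "is_interval (f ` {a<..<b})"
    using connected_continuous_image[OF f] by (simp add: is_interval_connected_1)
  moreover have "f s \<le> 0 \<and> 0 \<le> f t \<or> f t \<le> 0 \<and> 0 \<le> f s"
    using ne by (auto simp: sgn_if split: if_splits)
  ultimately have "0 \<in> f ` {a<..<b}"
    using assms(3,4) unfolding is_interval_1 by blast
  with nz show False by force
qed

section \<open>The two arcs meeting at the junction\<close>

context extremal_lift
begin

text \<open>The derivative of a function vanishing on an open interval vanishes there too, and below
  order \<open>2 * q\<close> the time derivative of \<open>A_coef P k\<close> is
  \<open>A_coef P (Suc k)\<close>.\<close>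

lemma A_coef_zero_on_singular:
  assumes q: "has_intrinsic_order P q" and sub: "{a<..<b} \<subseteq> {0..T}"
    and v: "continuous_on {a<..<b} v" and ae: "AE t in lebesgue_on {a<..<b}. v t = u t"
    and sing: "\<And>t. t \<in> {a<..<b} \<Longrightarrow> switching P (z t) = 0"
    and "k < 2 * q" and "t \<in> {a<..<b}"
  shows "A_coef P k (z t) = 0"
  using \<open>k < 2 * q\<close> \<open>t \<in> {a<..<b}\<close>
proof (induction k arbitrary: t)
  case 0
  then show ?case by (simp add: A_coef_def sing)
next
  case (Suc k)
  show ?case
  proof (subst vec_eq_iff, intro allI)
    fix i
    have "((\<lambda>t. A_coef P k (z t) $ i) has_real_derivative switching_deriv P (Suc k) (z t) (v t) $ i) (at t)"
      using Suc.prems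
      by (intro A_coef_has_derivative P switching_deriv_below_order[OF P q] z_has_derivative[OF sub v ae]) auto
    then have "((\<lambda>t. A_coef P k (z t) $ i) has_real_derivative A_coef P (Suc k) (z t) $ i) (at t)"
      by (simp only: switching_deriv_below_order[OF P q Suc.prems(1)])
    moreover have "((\<lambda>t. A_coef P k (z t) $ i) has_real_derivative 0) (at t)"
      by (rule has_field_derivative_transform_within_open[OF DERIV_const, of "{a<..<b}"])
         (use Suc in auto)
    ultimately show "A_coef P (Suc k) (z t) $ i = 0 $ i"
      using DERIV_unique by auto
  qed
qed

text \<open>Almost everywhere the maximum condition gives
  \<open>\<bar>v t $ i\<bar> = bound P t\<close>, and continuity extends this to the whole interval.
  As the bound is positive, no component of \<open>v\<close> has a zero, so each keeps its sign. The
  switching functions may vanish on a null set, which is why the sign is read off from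
  \<open>v\<close> and not from them.\<close>

lemma bang_control:
  assumes "a < b" and sub: "{a<..<b} \<subseteq> {0..T}"
    and v: "continuous_on {a<..<b} v" and ae: "AE t in lebesgue_on {a<..<b}. v t = u t"
    and nonsing: "\<And>i. AE t in lebesgue_on {a<..<b}. switching P (z t) $ i \<noteq> 0"
  obtains \<epsilon> where "\<And>i. \<epsilon> $ i \<noteq> 0" "\<And>t. t \<in> {a<..<b} \<Longrightarrow> v t = bound P t *\<^sub>R \<epsilon>"
    "\<And>t i. t \<in> {a<..<b} \<Longrightarrow> 0 \<le> \<epsilon> $ i * switching P (z t) $ i"
proof -
  let ?\<phi> = "\<lambda>i t. switching P (z t) $ i"
  have \<phi>: "continuous_on {a<..<b} (?\<phi> i)" for i
    by (intro phase_algebra_continuous_on phase_algebra_switching P continuous_on_subset[OF z_continuous sub])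
  have K: "continuous_on {a<..<b} (bound P)"
    by (rule continuous_on_subset[OF bound_continuous sub])
  have vi: "continuous_on {a<..<b} (\<lambda>t. v t $ i)" for i
    by (rule continuous_on_component[OF v])
  have Kpos: "0 < bound P t" if "t \<in> {a<..<b}" for t
    using that sub bound_pos by auto
  have max: "AE t in lebesgue_on {a<..<b}. \<forall>i. \<bar>?\<phi> i t\<bar> * bound P t \<le> ?\<phi> i t * u t $ i"
    by (rule AE_lebesgue_on_subset[OF switching_maximum sub]) auto
  have box: "AE t in lebesgue_on {a<..<b}. \<bar>u t $ i\<bar> \<le> bound P t" for i
    using adm sub by (intro AE_I2) (auto simp: admissible_def control_box_def)
  have max_v: "AE t in lebesgue_on {a<..<b}. \<bar>?\<phi> i t\<bar> * bound P t \<le> ?\<phi> i t * v t $ i" for i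
    using max ae by eventually_elim simp
  have le_v: "AE t in lebesgue_on {a<..<b}. \<bar>v t $ i\<bar> \<le> bound P t" for i
    using box[of i] ae by eventually_elim simp
  have ge_v: "AE t in lebesgue_on {a<..<b}. bound P t \<le> \<bar>v t $ i\<bar>" for i
    using max_v[of i] nonsing[of i]
  proof eventually_elim
    case (elim t)
    have "\<bar>?\<phi> i t\<bar> * bound P t \<le> \<bar>?\<phi> i t\<bar> * \<bar>v t $ i\<bar>"
      using elim(1) abs_ge_self[of "?\<phi> i t * v t $ i"] by (simp add: abs_mult)
    with elim(2) show ?case by simp
  qed
  have abs_v: "\<bar>v t $ i\<bar> = bound P t" if "t \<in> {a<..<b}" for t i
    using AE_le_imp_le_continuous[OF le_v _ K that] AE_le_imp_le_continuous[OF ge_v K _ that]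
      continuous_on_rabs[OF vi] by (simp add: order_antisym)
  have max_v': "\<bar>?\<phi> i t\<bar> * bound P t \<le> ?\<phi> i t * v t $ i" if "t \<in> {a<..<b}" for t i
    by (rule AE_le_imp_le_continuous[OF max_v _ _ that])
       (intro continuous_on_mult continuous_on_rabs \<phi> vi K)+
  obtain t0 where t0: "t0 \<in> {a<..<b}" using \<open>a < b\<close> dense by auto
  define \<epsilon> where "\<epsilon> = (\<chi> i. sgn (v t0 $ i))"
  have nz: "v t $ i \<noteq> 0" if "t \<in> {a<..<b}" for t i
    using abs_v[OF that, of i] Kpos[OF that] by auto
  have v_eq: "v t $ i = bound P t * \<epsilon> $ i" if "t \<in> {a<..<b}" for t i
    using continuous_nonzero_sgn_eq[OF vi nz that t0, of i] abs_v[OF that, of i] sgn_mult_abs[of "v t $ i"]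
    by (simp add: \<epsilon>_def mult.commute)
  show thesis
  proof (rule that)
    show "\<epsilon> $ i \<noteq> 0" for i using nz[OF t0] by (simp add: \<epsilon>_def sgn_zero_iff)
    show "v t = bound P t *\<^sub>R \<epsilon>" if "t \<in> {a<..<b}" for t
      using v_eq[OF that] by (simp add: vec_eq_iff)
    show "0 \<le> \<epsilon> $ i * ?\<phi> i t" if "t \<in> {a<..<b}" for t i
    proof -
      have "0 \<le> \<bar>?\<phi> i t\<bar> * bound P t"
        using Kpos[OF that] by simp
      also have "\<dots> \<le> bound P t * (\<epsilon> $ i * ?\<phi> i t)"
        using max_v'[OF that, of i] v_eq[OF that, of i] by (simp add: mult_ac)
      finally show ?thesis
        using Kpos[OF that] by (simp add: zero_le_mult_iff)
    qed
  qed
qed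

text \<open>In the parametrisation \<open>t = tc + \<sigma> * s\<close> every derivative picks up a factor \<open>\<sigma>\<close>; it disappears at the
  even order \<open>2 * q\<close>, which makes the sign independent of the side.\<close>

lemma B_coef_sign_at_junction:
  assumes q: "has_intrinsic_order P q" and \<sigma>: "\<sigma> \<in> {1, -1}" and \<delta>: "0 < \<delta>"
    and side: "side tc \<delta> \<sigma> = {a<..<b}" "{a<..<b} \<subseteq> {0..T}" and tc: "tc \<in> {0..T}"
    and v: "continuous_on {a<..<b} v" and ae: "AE t in lebesgue_on {a<..<b}. v t = u t"
    and v_eq: "\<And>t. t \<in> {a<..<b} \<Longrightarrow> v t = bound P t *\<^sub>R \<epsilon>"
    and sgn: "\<And>t. t \<in> {a<..<b} \<Longrightarrow> 0 \<le> \<epsilon> $ i * switching P (z t) $ i"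
    and A0: "\<And>k. k \<le> 2 * q \<Longrightarrow> A_coef P k (z tc) = 0"
  shows "0 \<le> \<epsilon> $ i * (B_coef P (2 * q) (z tc) *v \<epsilon>) $ i"
proof (rule ccontr)
  assume "\<not> ?thesis"
  then have neg: "\<epsilon> $ i * (B_coef P (2 * q) (z tc) *v \<epsilon>) $ i < 0" by simp
  let ?t = "\<lambda>s. tc + \<sigma> * s"
  let ?sd = "\<lambda>k t w. switching_deriv P k (z t) w $ i"
  \<comment> \<open>For \<open>s > 0\<close>, \<open>d k\<close> is the \<open>k\<close>-th
    derivative in \<open>s\<close> of \<open>\<epsilon> $ i\<close> times the switching component at
    \<open>tc + \<sigma> * s\<close>. At \<open>s = 0\<close> the control is replaced by its limit
    \<open>bound P tc *\<^sub>R \<epsilon>\<close> from the nonsingular side.\<close>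
  define d where "d = (\<lambda>k s. \<sigma> ^ k * (\<epsilon> $ i * ?sd k (?t s) (bound P (?t s) *\<^sub>R \<epsilon>)))"
  have below: "switching_deriv P k (z t) w = A_coef P k (z t)" if "k < 2 * q" for k t w
    by (rule switching_deriv_below_order[OF P q that])
  have order: "switching_deriv P (2 * q) (z t) w = A_coef P (2 * q) (z t) + B_coef P (2 * q) (z t) *v w" for t w
    by (rule switching_deriv_at_order[OF P q])
  have t_side: "?t s \<in> {a<..<b}" if "s \<in> {0<..<\<delta>}" for s
    using that unfolding side(1)[symmetric] side_def by blast
  have t_0T: "?t s \<in> {0..T}" if "s \<in> {0..<\<delta>}" for s
    using t_side[of s] side(2) tc that by (cases "s = 0") auto
  have t_cont: "continuous_on {0..<\<delta>} ?t"
    by (intro continuous_intros)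
  have z_cont: "continuous_on {0..<\<delta>} (\<lambda>s. z (?t s))"
    using continuous_on_compose2[OF z_continuous t_cont] t_0T by blast
  have K_cont: "continuous_on {0..<\<delta>} (\<lambda>s. bound P (?t s))"
    using continuous_on_compose2[OF bound_continuous t_cont] t_0T by blast
  have sd_cont: "continuous_on {0..<\<delta>} (\<lambda>s. ?sd k (?t s) w)" for k w
    by (intro phase_algebra_continuous_on[OF _ z_cont] phase_algebra_switching_deriv P)
  have "\<exists>\<eta>>0. \<eta> \<le> \<delta> \<and> (\<forall>s\<in>{0<..<\<eta>}. d 0 s < 0)"
  proof (rule one_sided_derivatives_negative[OF \<delta>, of "2 * q" d])
    show "continuous_on {0..<\<delta>} (d k)" if "k \<le> 2 * q" for k
    proof (cases "k = 2 * q")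
      case True
      \<comment> \<open>Affinity in the control reduces the varying value
        \<open>bound P (?t s) *\<^sub>R \<epsilon>\<close> to the fixed values 0 and
        \<open>\<epsilon>\<close>, for which continuity is known.\<close>
      have "d k = (\<lambda>s. \<sigma> ^ k * (\<epsilon> $ i * (?sd k (?t s) 0 +
          bound P (?t s) * (?sd k (?t s) \<epsilon> - ?sd k (?t s) 0))))"
        unfolding d_def True order by (simp add: matrix_vector_mult_scaleR)
      then show ?thesis
        by (simp only:) (intro continuous_on_mult continuous_on_add continuous_on_diff continuous_on_const sd_cont K_cont)
    next
      case False
      then have "d k = (\<lambda>s. \<sigma> ^ k * (\<epsilon> $ i * ?sd k (?t s) 0))"
        using that by (simp add: d_def below)
      then show ?thesis
        by (simp only:) (intro continuous_on_mult continuous_on_const sd_cont)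
    qed
    show "(d k has_real_derivative d (Suc k) s) (at s)" if k: "k < 2 * q" and s: "s \<in> {0<..<\<delta>}" for k s
    proof -
      have "((\<lambda>t. A_coef P k (z t) $ i) has_real_derivative ?sd (Suc k) (?t s) (v (?t s))) (at (?t s))"
        by (intro A_coef_has_derivative P switching_deriv_below_order[OF P q k]
            z_has_derivative[OF side(2) v ae] t_side s)
      moreover have "(?t has_real_derivative \<sigma>) (at s)"
        by (auto intro!: derivative_eq_intros)
      ultimately have "((\<lambda>s. A_coef P k (z (?t s)) $ i) has_real_derivative
          ?sd (Suc k) (?t s) (v (?t s)) * \<sigma>) (at s)"
        by (rule DERIV_chain2)
      from DERIV_cmult[OF DERIV_cmult[OF this]]
      have "((\<lambda>s. \<sigma> ^ k * (\<epsilon> $ i * A_coef P k (z (?t s)) $ i)) has_real_derivative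
          \<sigma> ^ k * (\<epsilon> $ i * (?sd (Suc k) (?t s) (v (?t s)) * \<sigma>))) (at s)" .
      then show ?thesis
        unfolding d_def below[OF k] v_eq[OF t_side[OF s]] by (simp only: power_Suc mult_ac)
    qed
    show "d k 0 = 0" if "k < 2 * q" for k
      using that A0[of k] by (simp add: d_def below)
    have "\<sigma> ^ (2 * q) = 1"
      using \<sigma> by (auto simp: power_mult)
    then have "d (2 * q) 0 = bound P tc * (\<epsilon> $ i * (B_coef P (2 * q) (z tc) *v \<epsilon>) $ i)"
      using A0[of "2 * q"] by (simp add: d_def order matrix_vector_mult_scaleR)
    also have "\<dots> < 0"
      using neg bound_pos[of tc] tc by (simp add: mult_less_0_iff)
    finally show "d (2 * q) 0 < 0" .
  qed
  then obtain \<eta> where \<eta>: "0 < \<eta>" "\<eta> \<le> \<delta>" "\<And>s. s \<in> {0<..<\<eta>} \<Longrightarrow> d 0 s < 0"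
    by blast
  have "\<eta> / 2 \<in> {0<..<\<eta>}" "\<eta> / 2 \<in> {0<..<\<delta>}" using \<eta> by auto
  from \<eta>(3)[OF this(1)] sgn[OF t_side[OF this(2)]] show False
    by (simp add: d_def)
qed

end

section \<open>Contradiction between maximum condition and Legendre-Clebsch condition\<close>

theorem mainTheorem3:
  fixes P :: "('n::finite, 'm::finite) affine_problem"
    and T tc l :: real and q :: nat
    and u :: "real \<Rightarrow> real ^ 'm" and x p :: "real \<Rightarrow> real ^ 'n"
    and S N :: "real set"
  assumes "analytic_problem P"
    and "optimal P T u x"
    and "pmp_lift P T u x l p"
    and "has_intrinsic_order P q"
    and "junction P T (extremal P u x l p) tc S N"
    and "glc_condition P q (extremal P u x l p) S"
    and "\<forall>\<^sub>F t in nhds tc. invertible (B_coef P (2 * q) (extremal P u x l p t))"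
    and "\<forall>t\<in>S. \<forall>i. \<bar>u t $ i\<bar> < bound P t"
    and "even q"
    and "\<forall>t\<in>S. A_coef P (2 * q) (extremal P u x l p t) = 0"
  shows "\<not> analytic_junction u tc"
proof
  assume "analytic_junction u tc"
  then obtain a b v where "a < tc" "tc < b" and vu: "AE t in lebesgue_on {a<..<b}. v t = u t"
    and "piecewise_analytic v a b"
    unfolding analytic_junction_def by blast
  then obtain t1 t2 where t12: "t1 \<in> {a<..<tc}" "t2 \<in> {tc<..<b}"
    and v: "real_analytic_on v {t1<..<tc}" "real_analytic_on v {tc<..<t2}"
    unfolding piecewise_analytic_def by (meson greaterThanLessThan_iff)
  interpret extremal_lift P T l u x p
    using assms by unfold_locales (auto simp: optimal_def)
  note q = assms(4)
  let ?B = "\<lambda>t. B_coef P (2 * q) (z t)"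
  have S: "is_interval S" "interior S \<noteq> {}" "S \<subseteq> {0..T}" "tc \<in> frontier S"
    and sing: "\<And>t. t \<in> S \<Longrightarrow> switching P (z t) = 0"
    and N: "is_interval N" "interior N \<noteq> {}" "N \<subseteq> {0..T}" "tc \<in> frontier N"
    and nonsing: "\<And>i. AE t in lebesgue_on N. switching P (z t) $ i \<noteq> 0"
    using assms(5)
    by (auto simp: junction_def singular_interval_def nonsingular_interval_def time_interval_def vec_eq_iff)
  obtain \<tau> \<delta>1 where \<tau>: "\<tau> \<in> {1, -1}" "0 < \<delta>1" "\<And>s. s \<in> {0<..<\<delta>1} \<Longrightarrow> tc + \<tau> * s \<in> S"
    using is_interval_side[OF S(1,2,4)] by blast
  obtain \<sigma> \<delta>2 where \<sigma>: "\<sigma> \<in> {1, -1}" "0 < \<delta>2" "\<And>s. s \<in> {0<..<\<delta>2} \<Longrightarrow> tc + \<sigma> * s \<in> N"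
    using is_interval_side[OF N(1,2,4)] by blast
  \<comment> \<open>One length for both sides: the singular side lies in \<open>S\<close>, the
    nonsingular one in \<open>N\<close>, and both within the two pieces on which \<open>v\<close> is
    analytic.\<close>
  define \<delta> where "\<delta> = Min {\<delta>1, \<delta>2, tc - t1, t2 - tc}"
  have \<delta>: "0 < \<delta>" "\<delta> \<le> \<delta>1" "\<delta> \<le> \<delta>2" "\<delta> \<le> tc - t1" "\<delta> \<le> t2 - tc"
    using \<tau>(2) \<sigma>(2) t12 by (auto simp: \<delta>_def)
  obtain a1 b1 where 1: "a1 < b1" "side tc \<delta> \<tau> = {a1<..<b1}" "tc \<in> {a1..b1}"
    using side_interval[OF \<tau>(1) \<delta>(1)] by blast
  obtain a2 b2 where 2: "a2 < b2" "side tc \<delta> \<sigma> = {a2<..<b2}"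
    using side_interval[OF \<sigma>(1) \<delta>(1)] by blast
  have I1: "{a1<..<b1} \<subseteq> S" and I2: "{a2<..<b2} \<subseteq> N"
    using \<tau>(3) \<sigma>(3) \<delta> by (auto simp: side_def simp flip: 1(2) 2(2))
  have sub: "{a1<..<b1} \<subseteq> {0..T}" "{a2<..<b2} \<subseteq> {0..T}"
    using I1 I2 S N by auto
  have v_cont: "continuous_on (side tc \<delta> \<rho>) v" if "\<rho> \<in> {1, -1}" for \<rho>
  proof -
    have "side tc \<delta> \<rho> \<subseteq> {t1<..<tc} \<union> {tc<..<t2}"
      using that \<delta> by (auto simp: side_def)
    then have "isCont v t" if "t \<in> side tc \<delta> \<rho>" for t
      using that v[THEN real_analytic_on_imp_isCont] by blast
    then show ?thesis by (simp add: continuous_at_imp_continuous_on)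
  qed
  have ae: "AE t in lebesgue_on (side tc \<delta> \<rho>). v t = u t" if "\<rho> \<in> {1, -1}" for \<rho>
  proof (rule AE_lebesgue_on_subset[OF vu])
    show "side tc \<delta> \<rho> \<subseteq> {a<..<b}"
      using that \<delta> t12 by (auto simp: side_def)
    show "side tc \<delta> \<rho> \<in> sets lebesgue"
      by (rule side_interval[OF that \<delta>(1), of tc]) simp
  qed auto
  have tc: "tc \<in> {0..T}"
    using S closure_mono[of S "{0..T}"] by (auto simp: frontier_def)
  have cl: "closure {a1<..<b1} \<subseteq> {0..T}" "tc \<in> closure {a1<..<b1}"
    using 1(1,3) closure_mono[OF sub(1)] by simp_all
  have sd_cont: "continuous_on (closure {a1<..<b1}) (\<lambda>t. switching_deriv P k (z t) w $ i)" for k w i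
    by (intro phase_algebra_continuous_on phase_algebra_switching_deriv P continuous_on_subset[OF z_continuous cl(1)])
  \<comment> \<open>The coefficients vanish on the open singular side, by induction below order
    \<open>2 * q\<close> and by hypothesis at that order. Continuity carries this to
    \<open>tc\<close>, which need not belong to \<open>S\<close>.\<close>
  have A0: "A_coef P k (z tc) = 0" if "k \<le> 2 * q" for k
  proof (subst vec_eq_iff, intro allI)
    fix i
    have "A_coef P k (z t) = 0" if "t \<in> {a1<..<b1}" for t
    proof (cases "k = 2 * q")
      case True
      then show ?thesis using assms(10) I1 that by blast
    next
      case False
      show ?thesis
        by (rule A_coef_zero_on_singular[OF q sub(1) v_cont[OF \<tau>(1), unfolded 1(2)] ae[OF \<tau>(1), unfolded 1(2)]])
           (use sing I1 that False \<open>k \<le> 2 * q\<close> in auto)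
    qed
    then show "A_coef P k (z tc) $ i = 0 $ i"
      using continuous_constant_on_closure[OF sd_cont[of k 0 i] _ cl(2), of 0] by (simp add: A_coef_def)
  qed
  have nonsing2: "AE t in lebesgue_on {a2<..<b2}. switching P (z t) $ i \<noteq> 0" for i
    by (rule AE_lebesgue_on_subset[OF nonsing I2])
       (use real_interval_borel_measurable[OF N(1)] in auto)
  obtain \<epsilon> where \<epsilon>: "\<And>i. \<epsilon> $ i \<noteq> 0" "\<And>t. t \<in> {a2<..<b2} \<Longrightarrow> v t = bound P t *\<^sub>R \<epsilon>"
    "\<And>t i. t \<in> {a2<..<b2} \<Longrightarrow> 0 \<le> \<epsilon> $ i * switching P (z t) $ i"
    using bang_control[OF 2(1) sub(2) v_cont[OF \<sigma>(1), unfolded 2(2)] ae[OF \<sigma>(1), unfolded 2(2)] nonsing2]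
    by blast
  have nonneg: "0 \<le> \<epsilon> $ i * (?B tc *v \<epsilon>) $ i" for i
    by (rule B_coef_sign_at_junction[OF q \<sigma>(1) \<delta>(1) 2(2) sub(2) tc v_cont[OF \<sigma>(1), unfolded 2(2)]
        ae[OF \<sigma>(1), unfolded 2(2)] \<epsilon>(2,3) A0])
  \<comment> \<open>Since \<open>q\<close> is even the Legendre-Clebsch sign is 1. The inequality
    holds on the singular side and passes to \<open>tc\<close> in its closure.\<close>
  have "\<epsilon> \<bullet> (?B tc *v \<epsilon>) \<le> 0"
  proof (rule continuous_le_on_closure[OF _ cl(2), of "\<lambda>t. \<epsilon> \<bullet> (?B t *v \<epsilon>)"])
    \<comment> \<open>By affinity, \<open>?B t *v \<epsilon>\<close> is the difference of the order
      \<open>2 * q\<close> derivatives at control values \<open>\<epsilon>\<close> and 0, which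
      yields continuity of the quadratic form.\<close>
    have "(\<lambda>t. \<epsilon> \<bullet> (?B t *v \<epsilon>)) = (\<lambda>t. \<Sum>i\<in>UNIV. \<epsilon> $ i *
        (switching_deriv P (2 * q) (z t) \<epsilon> $ i - switching_deriv P (2 * q) (z t) 0 $ i))"
      by (simp add: switching_deriv_at_order[OF P q] inner_vec_def)
    then show "continuous_on (closure {a1<..<b1}) (\<lambda>t. \<epsilon> \<bullet> (?B t *v \<epsilon>))"
      by (simp only:) (intro continuous_on_sum continuous_on_mult continuous_on_diff continuous_on_const sd_cont)
    show "\<epsilon> \<bullet> (?B t *v \<epsilon>) \<le> 0" if "t \<in> {a1<..<b1}" for t
      using assms(6,9) I1 that by (auto simp: glc_condition_def negative_semidefinite_def)
  qed
  \<comment> \<open>A sum of nonnegative terms that is at most 0 has only zero terms. As no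
    \<open>\<epsilon> $ i\<close> vanishes, the whole vector \<open>?B tc *v \<epsilon>\<close> is
    zero.\<close>
  then have "(\<Sum>i\<in>UNIV. \<epsilon> $ i * (?B tc *v \<epsilon>) $ i) = 0"
    using sum_nonneg[of UNIV "\<lambda>i. \<epsilon> $ i * (?B tc *v \<epsilon>) $ i"] nonneg by (simp add: inner_vec_def)
  then have "\<epsilon> $ i * (?B tc *v \<epsilon>) $ i = 0" for i
    using nonneg by (subst (asm) sum_nonneg_eq_0_iff) auto
  with \<epsilon>(1) have "?B tc *v \<epsilon> = 0"
    by (simp add: vec_eq_iff)
  moreover have "invertible (?B tc)"
    using assms(7) by (rule eventually_nhds_x_imp_x)
  ultimately have "\<epsilon> = 0"
    using matrix_left_invertible_ker[of "?B tc"] by (auto simp: invertible_def)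
  with \<epsilon>(1) show False by simp
qed

end
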